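(* Consider the general network interaction model described in the context, with $n=|\mathcal{I}|$. Assume that the treatments $\{D_k\}_{k\in\mathcal{I}\cup\mathcal{J}}$ are mutually independent with $\Pr(D_i=d)=p_d^{\mathcal{I}}$ for $i\in\mathcal{I}$ and $\Pr(D_j=d)=p_d^{\mathcal{J}}$ for $j\in\mathcal{J}$, $d\in\{0,1\}$, and that for each $(d,r)\in\{0,1\}\times\mathcal{R}_i$, $(D_i,\boldsymbol{D}_{\mathcal{P}_i})$ is independent of $(Y_i(d,r),\boldsymbol{A}_{\mathcal{P}_i})$. Assume also that the potential outcomes $\{Y_i(d,r)\}_{(d,r)\in\{0,1\}\times\mathcal{R}_i}$ together with $\boldsymbol{A}_{\mathcal{P}_i}$ are independent across $i\in\mathcal{I}$ (not necessarily identically distributed). Suppose $(\beta_d^{wls},\beta_s^{wls})$ is determined (through a unique minimizer) by $$(\beta_0^{wls}, \beta_d^{wls}, \beta_s^{wls}) = \operatorname*{argmin}_{b_0, b_d, b_s\in\mathbb{R}} \sum_{i\in\mathcal{I}} \mathbb{E}\big[A_{1(i)}(Y_i - b_0 - b_d D_i - b_s \mathbb{L}_1(M_i \mid D_i, D_{1(i)}))^2\big],$$ where $\mathbb{L}_1(M_i \mid D_i, D_{1(i)}) := \gamma_{0,1} + \gamma_{d,1} D_i + \gamma_{s,1} D_{1(i)}$ and $(\gamma_{0,1}, \gamma_{d,1}, \gamma_{s,1}) = \operatorname*{argmin}_{a_0, a_d, a_s\in\mathbb{R}} \sum_{i\in\mathcal{I}} \mathbb{E}[A_{1(i)}(M_i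 - a_0 - a_d D_i - a_s D_{1(i)})^2]$. Then $$\text{(i)}\quad \beta_d^{wls} = \frac{n^{-1}\sum_{i\in\mathcal{I}} \sum_{(r, \vec{a}) \in \mathcal{R}_i \times (\{1\}\times \mathcal{A}_{i,-1})} \mathbb{E}[\delta_i(r) \mid \boldsymbol{A}_{\mathcal{P}_i} = \vec{a}]\, \Pr(R_i = r, \boldsymbol{A}_{\mathcal{P}_i} = \vec{a})}{n^{-1} \sum_{i\in\mathcal{I}} \Pr(A_{1(i)} = 1) },$$ $$\text{(ii)}\quad \beta_s^{wls} = \frac{1}{n} \sum_{i\in\mathcal{I}} \sum_{r = 1}^{n_i} \omega_i(r)\, \mathbb{E}[ \bar\tau_i^1(r) \mid R_i(1) \ge r > R_i(0)],$$ where $\mathcal{A}_{i,-1} := \{0,1\}^{n_i - 1}$ and $$\omega_i(r) := \frac{\Pr( R_i(1) \ge r > R_i(0))}{n^{-1} \sum_{k\in\mathcal{I}} \mathbb{E}[M_k^1 - M_k^0]},\qquad M_i^d := M_i(R_i(d)),\ d\in\{0,1\}.$$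
   Context: General network model. There are two disjoint finite samples: the focal sample $\mathcal{I}$ and the peer sample $\mathcal{J}$. Each $i\in\mathcal{I}$ has a fixed (non-random) set of potential peers $\mathcal{P}_i=\{1(i),\ldots,n_i(i)\}\subseteq\mathcal{J}$ with $n_i=|\mathcal{P}_i|\ge 1$, possibly varying with $i$; the sets $\mathcal{P}_i$ and $\mathcal{P}_{i'}$ are disjoint for $i\ne i'$. Each unit $k\in\mathcal{I}\cup\mathcal{J}$ has a random treatment $D_k\in\{0,1\}$; put $\boldsymbol{D}_{\mathcal{P}_i}=(D_{1(i)},\ldots,D_{n_i(i)})^\top$. Link connections are the random vector $\boldsymbol{A}_{\mathcal{P}_i}=(A_{1(i)},\ldots,A_{n_i(i)})^\top$ with values in $\mathcal{A}_i:=\{0,1\}^{n_i}$, where $A_{j(i)}=1$ means the treatment of the $j$-th peer affects $i$'s outcome. The number of treated effective peers is $R_i:=\boldsymbol{A}_{\mathcal{P}_i}^\top\boldsymbol{D}_{\mathcal{P}_i}\in\mathcal{R}_i:=\{0,1,\ldots,n_i\}$. For $(d,r)\in\{0,1\}\times\mathcal{R}_i$, $Y_i(d,r)$ is a real random variable (potential outcome), and the observed outcome is $Y_i=\sum_{(d,r)\in\{0,1\}\times\mathcal{R}_i}\mathbf{1}\{D_i=d,R_i=r\}Y_i(d,r)$. For each $i$, $M_i:\mathcal{R}_i\to\mathbb{R}$ is a known (deterministic) non-decreasing function; when written without argument, $M_i$ denotes the random variable $M_i(R_i)$. The treatment $D_{1(i)}$ of the first peer is used as the instrument. For $d\in\{0,1\}$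 define $R_i(d):=A_{1(i)}d+A_{2(i)}D_{2(i)}+\cdots+A_{n_i(i)}D_{n_i(i)}$, so that $R_i=D_{1(i)}R_i(1)+(1-D_{1(i)})R_i(0)$. Experimental design: the treatments $\{D_k\}_{k\in\mathcal{I}\cup\mathcal{J}}$ are mutually independent with $\Pr(D_i=d)=p_d^{\mathcal{I}}$ for $i\in\mathcal{I}$ and $\Pr(D_j=d)=p_d^{\mathcal{J}}$ for $j\in\mathcal{J}$, $d\in\{0,1\}$. In addition, for each $(d,r)\in\{0,1\}\times\mathcal{R}_i$, $(D_i,\boldsymbol{D}_{\mathcal{P}_i})$ is independent of $(Y_i(d,r),\boldsymbol{A}_{\mathcal{P}_i})$. Independence across units: the potential outcomes $\{Y_i(d,r)\}_{(d,r)\in\{0,1\}\times\mathcal{R}_i}$ together with $\boldsymbol{A}_{\mathcal{P}_i}$ are independent across $i\in\mathcal{I}$ (not necessarily identically distributed). Dependence between $\boldsymbol{A}_{\mathcal{P}_i}$ and the potential outcomes of $i$ is allowed. Potential outcomes have finite second moments. A term consisting of a conditional expectation given a null event multiplied by a zero weight is read as $0$. Effects: $\delta_i(r):=Y_i(1,r)-Y_i(0,r)$; for $r\in\{1,\ldots,n_i\}$, $\tau_i^1(d,r):=Y_i(d,r)-Y_i(d,r-1)$ and $\bar\tau_i^1(r):=\tau_i^1(1,r)p_1^{\mathcal{I}}+\tau_i^1(0,r)p_0^{\mathcal{I}}$. *)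

theory Defs
  imports "HOL-Probability.Probability"
begin

text \<open>
  Units of both samples live in one type; all random variables live on the sample space \<open>Prob\<close>.
  The \<open>j\<close>-th potential peer of \<open>i\<close> is \<open>peer i j\<close>, with \<open>j\<close> ranging over \<open>1, \<dots>, npeers i\<close>
  (one-based, so that \<open>peer i 1\<close> is the peer whose treatment is the instrument), and
  \<open>Link i j\<close> is the connection indicator of that peer. Treatments and links are binary, encoded in \<open>nat\<close>.
  \<open>PO i d r\<close> is the potential outcome and \<open>Expo i\<close> the known exposure function of \<open>i\<close>;
  their values outside \<open>d \<in> {0, 1}\<close>, \<open>r \<le> npeers i\<close> are irrelevant.
\<close>

record ('u, 'w) network =
  Prob :: "'w measure"
  Focal :: "'u set"
  PeerSample :: "'u set"
  npeers :: "'u \<Rightarrow> nat"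
  peer :: "'u \<Rightarrow> nat \<Rightarrow> 'u"
  Treat :: "'u \<Rightarrow> 'w \<Rightarrow> nat"
  Link :: "'u \<Rightarrow> nat \<Rightarrow> 'w \<Rightarrow> nat"
  PO :: "'u \<Rightarrow> nat \<Rightarrow> nat \<Rightarrow> 'w \<Rightarrow> real"
  Expo :: "'u \<Rightarrow> nat \<Rightarrow> real"

definition peers :: "('u, 'w, 'z) network_scheme \<Rightarrow> 'u \<Rightarrow> 'u set" where
  "peers N i = peer N i ` {1..npeers N i}"

definition network_model :: "('u, 'w, 'z) network_scheme \<Rightarrow> bool" where
  "network_model N \<longleftrightarrow>
     prob_space (Prob N) \<and>
     finite (Focal N) \<and> finite (PeerSample N) \<and> Focal N \<inter> PeerSample N = {} \<and>
     (\<forall>i\<in>Focal N. 1 \<le> npeers N i \<and> inj_on (peer N i) {1..npeers N i} \<and>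
                  peers N i \<subseteq> PeerSample N) \<and>
     (\<forall>i\<in>Focal N. \<forall>k\<in>Focal N. i \<noteq> k \<longrightarrow> peers N i \<inter> peers N k = {}) \<and>
     (\<forall>k\<in>Focal N \<union> PeerSample N. Treat N k \<in> measurable (Prob N) (count_space UNIV) \<and>
        (\<forall>\<omega>\<in>space (Prob N). Treat N k \<omega> \<in> {0, 1})) \<and>
     (\<forall>i\<in>Focal N. \<forall>j\<in>{1..npeers N i}. Link N i j \<in> measurable (Prob N) (count_space UNIV) \<and>
        (\<forall>\<omega>\<in>space (Prob N). Link N i j \<omega> \<in> {0, 1})) \<and>
     (\<forall>i\<in>Focal N. \<forall>d\<in>{0, 1}. \<forall>r\<in>{0..npeers N i}.
        PO N i d r \<in> borel_measurable (Prob N) \<and>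
        integrable (Prob N) (\<lambda>\<omega>. (PO N i d r \<omega>)\<^sup>2)) \<and>
     (\<forall>i\<in>Focal N. mono_on {0..npeers N i} (Expo N i))"

text \<open>The random vectors of peer treatments and of links, as lists of length \<open>npeers i\<close>.\<close>

definition peer_treats :: "('u, 'w, 'z) network_scheme \<Rightarrow> 'u \<Rightarrow> 'w \<Rightarrow> nat list" where
  "peer_treats N i \<omega> = map (\<lambda>j. Treat N (peer N i j) \<omega>) [1..<Suc (npeers N i)]"

definition links :: "('u, 'w, 'z) network_scheme \<Rightarrow> 'u \<Rightarrow> 'w \<Rightarrow> nat list" where
  "links N i \<omega> = map (\<lambda>j. Link N i j \<omega>) [1..<Suc (npeers N i)]"

definition binvecs :: "nat \<Rightarrow> nat list set" where
  "binvecs m = {a. length a = m \<and> set a \<subseteq> {0, 1}}"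

definition treated_peers :: "('u, 'w, 'z) network_scheme \<Rightarrow> 'u \<Rightarrow> 'w \<Rightarrow> nat" where
  "treated_peers N i \<omega> = (\<Sum>j = 1..npeers N i. Link N i j \<omega> * Treat N (peer N i j) \<omega>)"

definition treated_peers_at :: "('u, 'w, 'z) network_scheme \<Rightarrow> 'u \<Rightarrow> nat \<Rightarrow> 'w \<Rightarrow> nat" where
  "treated_peers_at N i d \<omega> =
     Link N i 1 \<omega> * d + (\<Sum>j = 2..npeers N i. Link N i j \<omega> * Treat N (peer N i j) \<omega>)"

definition outcome :: "('u, 'w, 'z) network_scheme \<Rightarrow> 'u \<Rightarrow> 'w \<Rightarrow> real" where
  "outcome N i \<omega> = (\<Sum>(d, r)\<in>{0, 1} \<times> {0..npeers N i}.
     of_bool (Treat N i \<omega> = d \<and> treated_peers N i \<omega> = r) * PO N i d r \<omega>)"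

definition exposure :: "('u, 'w, 'z) network_scheme \<Rightarrow> 'u \<Rightarrow> 'w \<Rightarrow> real" where
  "exposure N i \<omega> = Expo N i (treated_peers N i \<omega>)"

definition exposure_at :: "('u, 'w, 'z) network_scheme \<Rightarrow> 'u \<Rightarrow> nat \<Rightarrow> 'w \<Rightarrow> real" where
  "exposure_at N i d \<omega> = Expo N i (treated_peers_at N i d \<omega>)"

definition direct_effect :: "('u, 'w, 'z) network_scheme \<Rightarrow> 'u \<Rightarrow> nat \<Rightarrow> 'w \<Rightarrow> real" where
  "direct_effect N i r \<omega> = PO N i 1 r \<omega> - PO N i 0 r \<omega>"

text \<open>Used for \<open>1 \<le> r \<le> npeers i\<close> only (the subtraction \<open>r - 1\<close> is on \<open>nat\<close>).\<close>

definition spill_effect :: "('u, 'w, 'z) network_scheme \<Rightarrow> 'u \<Rightarrow> nat \<Rightarrow> nat \<Rightarrow> 'w \<Rightarrow> real" where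
  "spill_effect N i d r \<omega> = PO N i d r \<omega> - PO N i d (r - 1) \<omega>"

definition mean_spill_effect ::
  "('u, 'w, 'z) network_scheme \<Rightarrow> (nat \<Rightarrow> real) \<Rightarrow> 'u \<Rightarrow> nat \<Rightarrow> 'w \<Rightarrow> real" where
  "mean_spill_effect N pI i r \<omega> = spill_effect N i 1 r \<omega> * pI 1 + spill_effect N i 0 r \<omega> * pI 0"

definition experimental_design ::
  "('u, 'w, 'z) network_scheme \<Rightarrow> (nat \<Rightarrow> real) \<Rightarrow> (nat \<Rightarrow> real) \<Rightarrow> bool" where
  "experimental_design N pI pJ \<longleftrightarrow>
     prob_space.indep_vars (Prob N) (\<lambda>_. count_space UNIV) (Treat N) (Focal N \<union> PeerSample N) \<and>
     (\<forall>i\<in>Focal N. \<forall>d\<in>{0, 1}. \<P>(\<omega> in Prob N. Treat N i \<omega> = d) = pI d) \<and>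
     (\<forall>j\<in>PeerSample N. \<forall>d\<in>{0, 1}. \<P>(\<omega> in Prob N. Treat N j \<omega> = d) = pJ d) \<and>
     (\<forall>i\<in>Focal N. \<forall>d\<in>{0, 1}. \<forall>r\<in>{0..npeers N i}.
        prob_space.indep_var (Prob N)
          (count_space UNIV) (\<lambda>\<omega>. (Treat N i \<omega>, peer_treats N i \<omega>))
          (borel \<Otimes>\<^sub>M count_space UNIV) (\<lambda>\<omega>. (PO N i d r \<omega>, links N i \<omega>)))"

definition independent_units :: "('u, 'w, 'z) network_scheme \<Rightarrow> bool" where
  "independent_units N \<longleftrightarrow>
     prob_space.indep_vars (Prob N)
       (\<lambda>i. (\<Pi>\<^sub>M dr\<in>{0, 1} \<times> {0..npeers N i}. borel) \<Otimes>\<^sub>M count_space UNIV)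
       (\<lambda>i \<omega>. (\<lambda>dr\<in>{0, 1} \<times> {0..npeers N i}. PO N i (fst dr) (snd dr) \<omega>, links N i \<omega>))
       (Focal N)"

text \<open>
  Elementary conditional expectation given an event. Given a null event its value is \<open>0\<close> (division by zero),
  in line with the convention that such a term times a zero weight is \<open>0\<close>.
\<close>

definition cond_expect :: "'w measure \<Rightarrow> ('w \<Rightarrow> real) \<Rightarrow> ('w \<Rightarrow> bool) \<Rightarrow> real" where
  "cond_expect P X Q = (LINT \<omega>:{\<omega>\<in>space P. Q \<omega>}|P. X \<omega>) / \<P>(\<omega> in P. Q \<omega>)"

text \<open>\<open>\<gamma>\<close> is the coefficient triple (intercept, own treatment, instrument) of the projection.\<close>

definition lin_proj :: "('u, 'w, 'z) network_scheme \<Rightarrow> real \<times> real \<times> real \<Rightarrow> 'u \<Rightarrow> 'w \<Rightarrow> real" where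
  "lin_proj N \<gamma> i \<omega> =
     (case \<gamma> of (g0, gd, gs) \<Rightarrow> g0 + gd * real (Treat N i \<omega>) + gs * real (Treat N (peer N i 1) \<omega>))"

definition first_stage_loss :: "('u, 'w, 'z) network_scheme \<Rightarrow> real \<times> real \<times> real \<Rightarrow> real" where
  "first_stage_loss N = (\<lambda>(a0, ad, as). \<Sum>i\<in>Focal N. \<integral>\<omega>. real (Link N i 1 \<omega>) *
     (exposure N i \<omega> - a0 - ad * real (Treat N i \<omega>) - as * real (Treat N (peer N i 1) \<omega>))\<^sup>2 \<partial>Prob N)"

definition wls_loss ::
  "('u, 'w, 'z) network_scheme \<Rightarrow> real \<times> real \<times> real \<Rightarrow> real \<times> real \<times> real \<Rightarrow> real" where
  "wls_loss N \<gamma> = (\<lambda>(b0, bd, bs). \<Sum>i\<in>Focal N. \<integral>\<omega>. real (Link N i 1 \<omega>) *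
     (outcome N i \<omega> - b0 - bd * real (Treat N i \<omega>) - bs * lin_proj N \<gamma> i \<omega>)\<^sup>2 \<partial>Prob N)"

definition spill_weight :: "('u, 'w, 'z) network_scheme \<Rightarrow> 'u \<Rightarrow> nat \<Rightarrow> real" where
  "spill_weight N i r =
     \<P>(\<omega> in Prob N. treated_peers_at N i 1 \<omega> \<ge> r \<and> r > treated_peers_at N i 0 \<omega>) /
     ((\<Sum>k\<in>Focal N. \<integral>\<omega>. (exposure_at N k 1 \<omega> - exposure_at N k 0 \<omega>) \<partial>Prob N) / real (card (Focal N)))"

end

theory Submission
  imports Defs
begin

text \<open>
  In the centred regressors \<open>D - p\<close> and \<open>Z - q\<close> (own treatment and instrument), which are uncorrelated
  with each other and with constants under the weights \<open>A\<^sub>1\<close>, both weighted losses are separable quadratics.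
  Hence every coefficient is a ratio of a moment to a variance; the moments factor because own treatment,
  instrument, remaining peer treatments and (outcome, links) are independent. As the exposure depends on
  peers only, \<open>\<gamma>\<^sub>d = 0\<close>, so the own-treatment coefficient of the second stage is the moment of the
  outcome with \<open>D - p\<close>. In the moment with \<open>Z - q\<close>, switching the instrument on raises the number of treated
  effective peers by \<open>A\<^sub>1\<close>, which turns the outcome contrast into a spillover effect.
  Uniqueness of the second-stage minimizer forces all the denominators to be nonzero.
\<close>

text \<open>The obstacle is that the design makes the treatments independent of
  \<open>(Y d r, A)\<close> for one pair \<open>(d, r)\<close> at a time. The joint law of several
  potential outcomes is out of reach, and so is independence of an effect such as
  \<open>Y 1 r - Y 0 r\<close>. The observed outcome is therefore split into cells
  \<open>(d, r)\<close>, each cell is factored on its own, and the effects appear only afterwards,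
  when the factored cells are recombined by linearity. Apart from a single integrable variable
  \<open>U\<close> (a potential outcome or the constant 1), all variables take finitely many values.
  Integrability then follows by domination, and an expectation is factored by expanding it over the
  values of the remaining peer treatments and of the links. The factor that is not computed is
  identified by running the same expansion with constant functions of \<open>D\<close> and
  \<open>Z\<close>. The weight \<open>A1\<close> cannot be separated from the outcome, as links and
  potential outcomes may be dependent; it always travels with \<open>U\<close> as part of a function
  of the links.\<close>

section \<open>Minimizers of separable quadratics\<close>

text \<open>If \<open>m = k * s - c\<close> were nonzero, moving \<open>s\<close> by
  \<open>- m * u\<close> would change the value by \<open>m^2 * u * (k * u - 2)\<close>. The choice
  \<open>u = 1 / (|k| + 1)\<close> ensures \<open>k * u < 2\<close> whatever the sign of
  \<open>k\<close>, so the change would be negative.\<close>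

lemma quadratic_minimizer:
  fixes k c s :: real
  assumes "\<And>t. k * s\<^sup>2 - 2 * c * s \<le> k * t\<^sup>2 - 2 * c * t"
  shows "k * s = c"
proof (rule ccontr)
  assume "k * s \<noteq> c"
  define m where "m = k * s - c"
  have m: "m \<noteq> 0" using \<open>k * s \<noteq> c\<close> by (simp add: m_def)
  define u where "u = 1 / (\<bar>k\<bar> + 1)"
  have u: "u > 0" "k * u < 2"
    by (auto simp: u_def divide_simps)
  have "0 \<le> m\<^sup>2 * u * (k * u - 2)"
    using assms[of "s - m * u"] by (simp add: m_def power2_eq_square algebra_simps)
  moreover have "m\<^sup>2 * u * (k * u - 2) < 0"
    using m u by (intro mult_pos_neg mult_pos_pos) auto
  ultimately show False by simp
qed

text \<open>Changing one slope and compensating in the intercept keeps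
  \<open>a0 + p * ad + q * as\<close> fixed, so only one of the three quadratics varies.\<close>

lemma separable_minimizer:
  fixes x0 xd xs :: real
  assumes loss: "\<And>a0 ad as. G (a0, ad, as) = c - 2 * ((a0 + p * ad + q * as) * x0 + ad * xd + as * xs)
      + w * (a0 + p * ad + q * as)\<^sup>2 + kd * ad\<^sup>2 + ks * as\<^sup>2"
    and min: "is_arg_min G (\<lambda>_. True) (a0, ad, as)"
  shows "kd * ad = xd" "ks * as = xs"
proof -
  have le: "G (a0, ad, as) \<le> G b" for b
    using min by (cases b) (auto simp: is_arg_min_def not_less)
  show "kd * ad = xd"
  proof (rule quadratic_minimizer)
    show "kd * ad\<^sup>2 - 2 * xd * ad \<le> kd * t\<^sup>2 - 2 * xd * t" for t
      using le[of "(a0 + p * (ad - t), t, as)"] unfolding loss by (simp add: algebra_simps)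
  qed
  show "ks * as = xs"
  proof (rule quadratic_minimizer)
    show "ks * as\<^sup>2 - 2 * xs * as \<le> ks * t\<^sup>2 - 2 * xs * t" for t
      using le[of "(a0 + q * (as - t), ad, t)"] unfolding loss by (simp add: algebra_simps)
  qed
qed

text \<open>The second-stage regressor is itself a combination of 1, \<open>D\<close> and
  \<open>Z\<close>, hence the substitution in \<open>F\<close>. If \<open>kd\<close> or
  \<open>ks * \<gamma>s\<close> vanished, the loss would be constant along some direction through
  the minimizer, which uniqueness forbids.\<close>

lemma two_stage_minimizer:
  fixes x0 xd xs :: real
  assumes loss: "\<And>a0 ad as. F (a0, ad, as) = c - 2 * ((a0 + p * ad + q * as) * x0 + ad * xd + as * xs)
      + w * (a0 + p * ad + q * as)\<^sup>2 + kd * ad\<^sup>2 + ks * as\<^sup>2"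
    and G: "\<And>b0 bd bs. G (b0, bd, bs) = F (b0 + bs * \<gamma>0, bd + bs * \<gamma>d, bs * \<gamma>s)"
    and min: "{b. is_arg_min G (\<lambda>_. True) b} = {(\<beta>0, \<beta>d, \<beta>s)}"
  shows "kd \<noteq> 0" "ks * \<gamma>s \<noteq> 0" "kd * (\<beta>d + \<beta>s * \<gamma>d) = xd" "ks * \<gamma>s * \<beta>s = xs"
proof -
  have am: "is_arg_min G (\<lambda>_. True) (\<beta>0, \<beta>d, \<beta>s)" using min by blast
  have le: "G (\<beta>0, \<beta>d, \<beta>s) \<le> G b" for b
    using am by (cases b) (auto simp: is_arg_min_def not_less)
  have uniq: "b = (\<beta>0, \<beta>d, \<beta>s)" if "G b = G (\<beta>0, \<beta>d, \<beta>s)" for b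
  proof -
    have "is_arg_min G (\<lambda>_. True) b"
      using le that by (auto simp: is_arg_min_def not_less)
    with min show ?thesis by blast
  qed
  \<comment> \<open>The displacement is chosen to keep the centred intercept of \<open>F\<close>
    fixed while its other two arguments move by \<open>u\<close> and
    \<open>s * \<gamma>s\<close>.\<close>
  have shift: "G (b0 - p * u - s * (\<gamma>0 + p * \<gamma>d + q * \<gamma>s) + s * p * \<gamma>d, bd + u - s * \<gamma>d, bs + s) = 
      G (b0, bd, bs) - 2 * u * xd - 2 * s * \<gamma>s * xs 
      + kd * (2 * u * (bd + bs * \<gamma>d) + u\<^sup>2) + ks * \<gamma>s\<^sup>2 * (2 * s * bs + s\<^sup>2)" for b0 bd bs u s
    unfolding G loss by (simp add: power2_eq_square algebra_simps)
  show d: "kd * (\<beta>d + \<beta>s * \<gamma>d) = xd"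
  proof (rule quadratic_minimizer)
    fix t
    show "kd * (\<beta>d + \<beta>s * \<gamma>d)\<^sup>2 - 2 * xd * (\<beta>d + \<beta>s * \<gamma>d) \<le> kd * t\<^sup>2 - 2 * xd * t"
      using le[of "(\<beta>0 - p * (t - (\<beta>d + \<beta>s * \<gamma>d)), \<beta>d + (t - (\<beta>d + \<beta>s * \<gamma>d)), \<beta>s)"]
        shift[of \<beta>0 "t - (\<beta>d + \<beta>s * \<gamma>d)" 0 \<beta>d \<beta>s]
      by (simp add: power2_eq_square algebra_simps)
  qed
  show kd: "kd \<noteq> 0"
  proof
    \<comment> \<open>Then \<open>d\<close> gives \<open>xd = 0\<close>, and the displacement
      \<open>u = 1\<close> leads to a second minimizer.\<close>
    assume "kd = 0"
    then show False
      using uniq[of "(\<beta>0 - p, \<beta>d + 1, \<beta>s)"] shift[of \<beta>0 1 0 \<beta>d \<beta>s] d by simp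
  qed
  \<comment> \<open>Varying \<open>bs\<close> moves the instrument coefficient by multiples of
    \<open>\<gamma>s\<close>, which explains the extra factor; it is cancelled once
    \<open>ks * \<gamma>s\<close> is known to be nonzero.\<close>
  have s: "(ks * \<gamma>s\<^sup>2) * \<beta>s = \<gamma>s * xs"
  proof (rule quadratic_minimizer)
    fix t
    show "(ks * \<gamma>s\<^sup>2) * \<beta>s\<^sup>2 - 2 * (\<gamma>s * xs) * \<beta>s \<le> (ks * \<gamma>s\<^sup>2) * t\<^sup>2 - 2 * (\<gamma>s * xs) * t"
      using le[of "(\<beta>0 - (t - \<beta>s) * (\<gamma>0 + p * \<gamma>d + q * \<gamma>s) + (t - \<beta>s) * p * \<gamma>d,
          \<beta>d - (t - \<beta>s) * \<gamma>d, \<beta>s + (t - \<beta>s))"]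
        shift[of \<beta>0 0 "t - \<beta>s" \<beta>d \<beta>s]
      by (simp add: power2_eq_square algebra_simps)
  qed
  show ks: "ks * \<gamma>s \<noteq> 0"
  proof
    assume "ks * \<gamma>s = 0"
    then have "ks * \<gamma>s\<^sup>2 = 0" by (auto simp: power2_eq_square)
    with s have "\<gamma>s * xs = 0" by simp
    with \<open>ks * \<gamma>s\<^sup>2 = 0\<close> show False
      using uniq[of "(\<beta>0 - (\<gamma>0 + p * \<gamma>d + q * \<gamma>s) + p * \<gamma>d, \<beta>d - \<gamma>d, \<beta>s + 1)"]
        shift[of \<beta>0 0 1 \<beta>d \<beta>s] by auto
  qed
  show "ks * \<gamma>s * \<beta>s = xs"
    using s ks by (auto simp: power2_eq_square)
qed

section \<open>Indicator sums and elementary conditional expectations\<close>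

lemma sum_of_bool_pair:
  fixes \<phi> :: "'a \<Rightarrow> 'b \<Rightarrow> real"
  assumes "finite S" "finite S'" "x \<in> S" "y \<in> S'"
  shows "(\<Sum>(s, t)\<in>S \<times> S'. of_bool (x = s \<and> y = t) * \<phi> s t) = \<phi> x y"
proof -
  have "(\<Sum>(s, t)\<in>S \<times> S'. of_bool (x = s \<and> y = t) * \<phi> s t) =
      (\<Sum>z\<in>S \<times> S'. if z = (x, y) then case z of (s, t) \<Rightarrow> \<phi> s t else 0)"
    by (intro sum.cong) auto
  then show ?thesis using assms by simp
qed

lemma finite_binvecs: "finite (binvecs m)"
  unfolding binvecs_def by (rule finite_subset[OF _ finite_lists_length_eq[of "{0, 1}" m]]) auto

text \<open>On a null event both sides are 0, the right one because the indicator vanishes almost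
  everywhere. Null events thus need no separate treatment later.\<close>

lemma (in prob_space) cond_expect_mult_prob:
  assumes [measurable]: "{\<omega>\<in>space M. Q \<omega>} \<in> events"
  shows "cond_expect M X Q * \<P>(\<omega> in M. Q \<omega>) = (\<integral>\<omega>. of_bool (Q \<omega>) * X \<omega> \<partial>M)"
proof -
  have eq: "(\<integral>\<omega>. of_bool (Q \<omega>) * X \<omega> \<partial>M) = (LINT \<omega>:{\<omega>\<in>space M. Q \<omega>}|M. X \<omega>)"
    unfolding set_lebesgue_integral_def
    by (rule Bochner_Integration.integral_cong) (auto simp: indicator_def)
  show ?thesis
  proof (cases "\<P>(\<omega> in M. Q \<omega>) = 0")
    case True
    then have "AE \<omega> in M. \<not> Q \<omega>"
      by (subst (asm) prob_eq_0) auto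
    then have "(\<integral>\<omega>. of_bool (Q \<omega>) * X \<omega> \<partial>M) = 0"
      by (intro integral_eq_zero_AE) auto
    with True show ?thesis by simp
  next
    case False
    then show ?thesis by (simp add: cond_expect_def eq)
  qed
qed

text \<open>The design speaks about the vectors \<open>peer_treats\<close> and \<open>links\<close>,
  so the count of treated effective peers has to be written as a function of these two
  lists.\<close>

definition dot :: "nat list \<Rightarrow> nat list \<Rightarrow> nat" where
  "dot a t = sum_list (map2 (*) a t)"

section \<open>One focal unit: vectors, measurability, integrability\<close>

locale focal_unit =
  fixes N :: "('u, 'w) network" and pI pJ :: "nat \<Rightarrow> real" and i :: 'u
  assumes model: "network_model N"
    and design: "experimental_design N pI pJ"
    and focal: "i \<in> Focal N"
begin

abbreviation "P \<equiv> Prob N"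
abbreviation "n \<equiv> npeers N i"
abbreviation "D \<equiv> Treat N i"
abbreviation "Z \<equiv> Treat N (peer N i 1)"
abbreviation "T \<omega> \<equiv> tl (peer_treats N i \<omega>)"
abbreviation "A \<equiv> links N i"
abbreviation "A1 \<equiv> Link N i 1"
abbreviation "Y \<equiv> PO N i"

sublocale prob_space P
  using model by (simp add: network_model_def)

lemma npeers_pos: "1 \<le> n"
  using model focal by (simp add: network_model_def)

lemma upt_peers: "[1..<Suc n] = 1 # [2..<Suc n]"
  using npeers_pos by (simp add: upt_conv_Cons numeral_2_eq_2)

lemma peer_treats_Cons: "peer_treats N i \<omega> = Z \<omega> # T \<omega>"
  by (simp only: peer_treats_def upt_peers list.map list.sel)

lemma Z_eq: "Z \<omega> = hd (peer_treats N i \<omega>)"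
  by (subst peer_treats_Cons) simp

lemma T_eq: "T \<omega> = map (\<lambda>j. Treat N (peer N i j) \<omega>) [2..<Suc n]"
  by (simp only: peer_treats_def upt_peers list.map list.sel)

lemma links_Cons: "A \<omega> = A1 \<omega> # map (\<lambda>j. Link N i j \<omega>) [2..<Suc n]"
  by (simp only: links_def upt_peers list.map)

lemma A1_eq: "A1 \<omega> = hd (A \<omega>)"
  by (simp add: links_Cons)

lemma treated_peers_eq: "treated_peers N i \<omega> = dot (A \<omega>) (peer_treats N i \<omega>)"
proof -
  have "map2 (*) (A \<omega>) (peer_treats N i \<omega>) = 
      map (\<lambda>j. Link N i j \<omega> * Treat N (peer N i j) \<omega>) [1..<Suc n]"
    unfolding links_def peer_treats_def by (simp add: zip_map_map map_zip_map map_zip_map2 zip_same_conv_map del: upt_Suc)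
  then show ?thesis
    by (simp add: dot_def treated_peers_def interv_sum_list_conv_sum_set_nat atLeastLessThanSuc_atLeastAtMost del: upt_Suc)
qed

lemma treated_peers_at_eq: "treated_peers_at N i d \<omega> = dot (A \<omega>) (d # T \<omega>)"
proof -
  have "map2 (*) (A \<omega>) (d # T \<omega>) = A1 \<omega> * d #
      map (\<lambda>j. Link N i j \<omega> * Treat N (peer N i j) \<omega>) [2..<Suc n]"
    unfolding links_Cons T_eq by (simp add: zip_map_map map_zip_map map_zip_map2 zip_same_conv_map del: upt_Suc)
  then show ?thesis
    by (simp add: dot_def treated_peers_at_def interv_sum_list_conv_sum_set_nat atLeastLessThanSuc_atLeastAtMost del: upt_Suc)
qed

lemma treated_peers_at_Z: "treated_peers N i \<omega> = treated_peers_at N i (Z \<omega>) \<omega>"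
  by (simp only: treated_peers_eq treated_peers_at_eq peer_treats_Cons[symmetric])


text \<open>
  The two random variables of \<^const>\<open>prob_space.indep_var\<close> have a common type, so type inference
  inserts the coercion of \<open>D\<close> to the reals in \<^const>\<open>experimental_design\<close>.
\<close>

lemma indep_PO:
  assumes "d \<in> {0, 1}" "r \<in> {0..n}"
  shows "indep_var (count_space UNIV) (\<lambda>\<omega>. (real (D \<omega>), peer_treats N i \<omega>))
    (borel \<Otimes>\<^sub>M count_space UNIV) (\<lambda>\<omega>. (Y d r \<omega>, A \<omega>))"
  using design focal assms unfolding experimental_design_def prod.case by blast

lemma integrable_PO:
  assumes "d \<in> {0, 1}" "r \<in> {0..n}"
  shows "integrable P (Y d r)" "integrable P (\<lambda>\<omega>. (Y d r \<omega>)\<^sup>2)"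
proof -
  show sq: "integrable P (\<lambda>\<omega>. (Y d r \<omega>)\<^sup>2)"
    using model focal assms unfolding network_model_def by blast
  have "Y d r \<in> borel_measurable P"
    using model focal assms unfolding network_model_def by blast
  then show "integrable P (Y d r)"
    using sq by (rule square_integrable_imp_integrable)
qed

text \<open>A measurable map replaces \<open>Y 0 0\<close> by the constant 1. Factorisations stated
  for a pair \<open>(U, A)\<close> then also cover exposures and plain probabilities.\<close>

lemma indep_one:
  "indep_var (count_space UNIV) (\<lambda>\<omega>. (real (D \<omega>), peer_treats N i \<omega>))
    (borel \<Otimes>\<^sub>M count_space UNIV) (\<lambda>\<omega>. (1 :: real, A \<omega>))"
proof -
  have "(\<lambda>x. (1, snd x)) \<in> (borel :: real measure) \<Otimes>\<^sub>M (count_space UNIV :: nat list measure) \<rightarrow>\<^sub>M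
      (borel :: real measure) \<Otimes>\<^sub>M count_space UNIV"
    by measurable
  from indep_var_compose[OF indep_PO[of 0 0] measurable_id[unfolded id_def] this]
  show ?thesis by (simp add: o_def)
qed

lemma treats_measurable: "(\<lambda>\<omega>. (D \<omega>, peer_treats N i \<omega>)) \<in> P \<rightarrow>\<^sub>M count_space UNIV"
  \<comment> \<open>\<open>nat\<close> of the floor undoes the coercion of \<open>D\<close> to the
    reals.\<close>
  using measurable_compose[OF indep_var_rv1[OF indep_one], of "\<lambda>(x, t). (nat \<lfloor>x\<rfloor>, t)" "count_space UNIV"]
  by simp

lemma links_measurable: "A \<in> P \<rightarrow>\<^sub>M count_space UNIV"
  using measurable_compose[OF indep_var_rv2[OF indep_one] measurable_snd] by simp

text \<open>The value types are countable, so the product sigma-algebra is discrete again and every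
  function or event of these variables is measurable.\<close>

lemma design_measurable: "(\<lambda>\<omega>. ((D \<omega>, peer_treats N i \<omega>), A \<omega>)) \<in> P \<rightarrow>\<^sub>M count_space UNIV"
  using measurable_Pair[OF treats_measurable links_measurable] by (simp add: pair_measure_countable)

lemma D_binary: "\<omega> \<in> space P \<Longrightarrow> D \<omega> \<in> {0, 1}"
  using model focal by (simp add: network_model_def)

lemma peer_in_sample: "j \<in> {1..n} \<Longrightarrow> peer N i j \<in> PeerSample N"
  using model focal unfolding network_model_def peers_def by blast

lemma Z_in_sample: "peer N i 1 \<in> PeerSample N"
  using npeers_pos by (intro peer_in_sample) auto

lemma treat_binary: "\<omega> \<in> space P \<Longrightarrow> k \<in> Focal N \<union> PeerSample N \<Longrightarrow> Treat N k \<omega> \<in> {0, 1}"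
  using model by (auto simp: network_model_def)

lemma Z_binary: "\<omega> \<in> space P \<Longrightarrow> Z \<omega> \<in> {0, 1}"
  using treat_binary Z_in_sample by blast

lemma link_binary: "\<omega> \<in> space P \<Longrightarrow> j \<in> {1..n} \<Longrightarrow> Link N i j \<omega> \<in> {0, 1}"
  using model focal unfolding network_model_def by blast

lemma A1_binary: "\<omega> \<in> space P \<Longrightarrow> A1 \<omega> \<in> {0, 1}"
  using npeers_pos by (intro link_binary) auto

lemma links_binary:
  assumes "\<omega> \<in> space P"
  shows "A \<omega> \<in> binvecs n"
proof -
  have "set (A \<omega>) \<subseteq> {0, 1}"
    unfolding links_def set_map by (rule image_subsetI) (rule link_binary[OF assms], auto)
  then show ?thesis
    by (simp add: binvecs_def links_def del: upt_Suc)
qed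

lemma peer_treats_binary:
  assumes "\<omega> \<in> space P"
  shows "peer_treats N i \<omega> \<in> binvecs n"
proof -
  have "set (peer_treats N i \<omega>) \<subseteq> {0, 1}"
    unfolding peer_treats_def set_map
    by (rule image_subsetI) (rule treat_binary[OF assms], rule UnI2, rule peer_in_sample, auto)
  then show ?thesis
    by (simp add: binvecs_def peer_treats_def del: upt_Suc)
qed

lemma T_binary: "\<omega> \<in> space P \<Longrightarrow> T \<omega> \<in> binvecs (n - 1)"
  using peer_treats_binary[of \<omega>] by (cases "peer_treats N i \<omega>") (auto simp: binvecs_def)

text \<open>The arguments of \<open>h\<close> stay in the finite set \<open>?S\<close>; the sum
  \<open>?B\<close> of all absolute values of \<open>h\<close> on it is a bound, and
  \<open>?B * U\<close> dominates.\<close>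

lemma integrable_mult_discrete:
  fixes h :: "nat \<Rightarrow> nat list \<Rightarrow> nat list \<Rightarrow> real"
  assumes U: "integrable P U"
  shows "integrable P (\<lambda>\<omega>. h (D \<omega>) (peer_treats N i \<omega>) (A \<omega>) * U \<omega>)"
proof (rule Bochner_Integration.integrable_bound)
  let ?S = "{0, 1} \<times> binvecs n \<times> binvecs n"
  let ?B = "\<Sum>(d, t, a)\<in>?S. \<bar>h d t a\<bar>"
  show "integrable P (\<lambda>\<omega>. ?B * U \<omega>)" using U by simp
  from measurable_compose[OF design_measurable, of "\<lambda>((d, t), a). h d t a" borel]
  have "(\<lambda>\<omega>. h (D \<omega>) (peer_treats N i \<omega>) (A \<omega>)) \<in> borel_measurable P"
    by simp
  then show "(\<lambda>\<omega>. h (D \<omega>) (peer_treats N i \<omega>) (A \<omega>) * U \<omega>) \<in> borel_measurable P"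
    using U by measurable
  show "AE \<omega> in P. norm (h (D \<omega>) (peer_treats N i \<omega>) (A \<omega>) * U \<omega>) \<le> norm (?B * U \<omega>)"
  proof (rule AE_I2)
    fix \<omega> assume \<omega>: "\<omega> \<in> space P"
    then have "(D \<omega>, peer_treats N i \<omega>, A \<omega>) \<in> ?S"
      using D_binary peer_treats_binary links_binary by blast
    then have "(\<lambda>(d, t, a). \<bar>h d t a\<bar>) (D \<omega>, peer_treats N i \<omega>, A \<omega>) \<le> ?B"
      by (intro member_le_sum) (auto simp: finite_binvecs)
    then have "\<bar>h (D \<omega>) (peer_treats N i \<omega>) (A \<omega>)\<bar> \<le> \<bar>?B\<bar>" by simp
    then show "norm (h (D \<omega>) (peer_treats N i \<omega>) (A \<omega>) * U \<omega>) \<le> norm (?B * U \<omega>)"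
      by (simp add: abs_mult mult_right_mono)
  qed
qed

section \<open>The law of the treatments\<close>

lemma treat_measurable: "k \<in> Focal N \<union> PeerSample N \<Longrightarrow> Treat N k \<in> P \<rightarrow>\<^sub>M count_space UNIV"
  using model by (simp add: network_model_def)

lemma expectation_treat:
  fixes f :: "nat \<Rightarrow> real"
  assumes k: "k \<in> Focal N \<union> PeerSample N"
  shows "(\<integral>\<omega>. f (Treat N k \<omega>) \<partial>P) =
    f 0 * \<P>(\<omega> in P. Treat N k \<omega> = 0) + f 1 * \<P>(\<omega> in P. Treat N k \<omega> = 1)"
proof -
  let ?E = "\<lambda>x. {\<omega>\<in>space P. Treat N k \<omega> = x}"
  have [measurable]: "?E x \<in> events" for x
    using treat_measurable[OF k] by measurable
  have int: "integrable P (indicat_real (?E x))" for x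
    by (intro integrable_real_indicator) (auto simp: less_top[symmetric])
  have "(\<integral>\<omega>. f (Treat N k \<omega>) \<partial>P) = (\<integral>\<omega>. f 0 * indicator (?E 0) \<omega> + f 1 * indicator (?E 1) \<omega> \<partial>P)"
  proof (rule Bochner_Integration.integral_cong)
    fix \<omega> assume \<omega>: "\<omega> \<in> space P"
    from treat_binary[OF \<omega> k] \<omega>
    show "f (Treat N k \<omega>) = f 0 * indicator (?E 0) \<omega> + f 1 * indicator (?E 1) \<omega>"
      by (auto simp: indicator_def)
  qed simp
  also have "\<dots> = f 0 * prob (?E 0) + f 1 * prob (?E 1)"
    using int by (subst Bochner_Integration.integral_add) auto
  finally show ?thesis .
qed

lemma prob_D: "d \<in> {0, 1} \<Longrightarrow> \<P>(\<omega> in P. D \<omega> = d) = pI d"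
  using design focal unfolding experimental_design_def by blast

lemma prob_Z: "d \<in> {0, 1} \<Longrightarrow> \<P>(\<omega> in P. Z \<omega> = d) = pJ d"
  using design Z_in_sample unfolding experimental_design_def by blast

lemma expectation_D: "(\<integral>\<omega>. f (D \<omega>) \<partial>P) = f 0 * pI 0 + f 1 * pI 1" for f :: "nat \<Rightarrow> real"
  using focal by (subst expectation_treat) (simp_all only: prob_D insert_iff Un_iff simp_thms)

lemma expectation_Z: "(\<integral>\<omega>. f (Z \<omega>) \<partial>P) = f 0 * pJ 0 + f 1 * pJ 1" for f :: "nat \<Rightarrow> real"
  using Z_in_sample by (subst expectation_treat) (simp_all only: prob_Z insert_iff Un_iff simp_thms)

lemma pI_sum: "pI 0 + pI 1 = 1"
  using expectation_D[of "\<lambda>_. 1", symmetric] by (simp add: prob_space)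

lemma pJ_sum: "pJ 0 + pJ 1 = 1"
  using expectation_Z[of "\<lambda>_. 1", symmetric] by (simp add: prob_space)

text \<open>Mutual independence concerns units, whereas the product runs over positions: 0 for the
  focal unit, \<open>j\<close> for its \<open>j\<close>-th peer. Disjointness of the samples and
  distinctness of the peers make \<open>u\<close> injective, which permits the reindexing.\<close>

lemma expectation_treats_prod:
  fixes \<psi> :: "nat \<Rightarrow> nat \<Rightarrow> real"
  defines "u \<equiv> (\<lambda>j. if j = 0 then i else peer N i j)"
  shows "(\<integral>\<omega>. (\<Prod>j\<in>{0..n}. \<psi> j (Treat N (u j) \<omega>)) \<partial>P) = (\<Prod>j\<in>{0..n}. \<integral>\<omega>. \<psi> j (Treat N (u j) \<omega>) \<partial>P)"
proof -
  have inj: "inj_on u {0..n}"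
  proof (rule inj_onI)
    fix j k assume jk: "j \<in> {0..n}" "k \<in> {0..n}" "u j = u k"
    have inj_peer: "inj_on (peer N i) {1..n}"
      using model focal by (simp only: network_model_def)
    have "Focal N \<inter> PeerSample N = {}"
      using model by (simp only: network_model_def)
    then have notin: "i \<notin> PeerSample N"
      using focal by blast
    have u0: "u 0 = i" and us: "u l = peer N i l" if "l \<noteq> 0" for l
      using that by (simp_all only: u_def if_True if_False simp_thms)
    have mem: "l \<in> {1..n}" if "l \<noteq> 0" "l \<in> {0..n}" for l
      using that by simp
    have ne: "u l \<noteq> u 0" if "l \<noteq> 0" "l \<in> {0..n}" for l
    proof
      assume "u l = u 0"
      then have "peer N i l = i" using u0 us that(1) by simp
      with peer_in_sample[OF mem[OF that]] notin show False by simp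
    qed
    show "j = k"
    proof (cases "j = 0 \<or> k = 0")
      case True
      then show ?thesis using ne[of j] ne[of k] jk by metis
    next
      case False
      then have "peer N i j = peer N i k"
        using jk(3) us[of j] us[of k] by (simp only: de_Morgan_disj simp_thms)
      then show ?thesis
        using inj_onD[OF inj_peer _ mem[OF _ jk(1)] mem[OF _ jk(2)]] False by simp
    qed
  qed
  have sub: "u ` {0..n} \<subseteq> Focal N \<union> PeerSample N"
    using focal peer_in_sample by (auto simp: u_def)
  \<comment> \<open>\<open>\<phi>\<close> transports the function attached to a position to the unit
    at that position.\<close>
  define \<phi> where "\<phi> k = \<psi> (inv_into {0..n} u k)" for k
  have \<phi>: "\<phi> (u j) = \<psi> j" if "j \<in> {0..n}" for j
    using that inj by (simp add: \<phi>_def)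
  have "indep_vars (\<lambda>_. count_space UNIV) (Treat N) (Focal N \<union> PeerSample N)"
    using design unfolding experimental_design_def by blast
  from indep_vars_subset[OF this sub] have indep: "indep_vars (\<lambda>_. borel) (\<lambda>k \<omega>. \<phi> k (Treat N k \<omega>)) (u ` {0..n})"
    by (rule indep_vars_compose2) simp
  have int: "integrable P (\<lambda>\<omega>. \<phi> k (Treat N k \<omega>))" if "k \<in> u ` {0..n}" for k
  proof (rule integrable_const_bound)
    have k: "k \<in> Focal N \<union> PeerSample N" using that sub by blast
    show "(\<lambda>\<omega>. \<phi> k (Treat N k \<omega>)) \<in> borel_measurable P"
      by (rule measurable_compose[OF treat_measurable[OF k]]) simp
    show "AE \<omega> in P. norm (\<phi> k (Treat N k \<omega>)) \<le> \<bar>\<phi> k 0\<bar> + \<bar>\<phi> k 1\<bar>"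
    proof (rule AE_I2)
      fix \<omega> assume "\<omega> \<in> space P"
      from treat_binary[OF this k] show "norm (\<phi> k (Treat N k \<omega>)) \<le> \<bar>\<phi> k 0\<bar> + \<bar>\<phi> k 1\<bar>"
        by auto
    qed
  qed
  have "(\<integral>\<omega>. (\<Prod>k\<in>u ` {0..n}. \<phi> k (Treat N k \<omega>)) \<partial>P) =
      (\<Prod>k\<in>u ` {0..n}. \<integral>\<omega>. \<phi> k (Treat N k \<omega>) \<partial>P)"
    by (rule indep_vars_lebesgue_integral[OF _ indep int]) simp_all
  then show ?thesis
    unfolding prod.reindex[OF inj] o_def by (simp only: \<phi> cong: prod.cong)
qed

text \<open>A product over the peers is the form to which mutual independence applies. Peers are
  numbered from 1 and \<open>T\<close> omits the first, while list positions start at 0: hence the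
  shift by 2.\<close>

lemma T_eq_iff:
  assumes "length t = n - 1"
  shows "of_bool (T \<omega> = t) = (\<Prod>j\<in>{2..n}. of_bool (Treat N (peer N i j) \<omega> = t ! (j - 2)) :: real)"
proof -
  have "T \<omega> = t \<longleftrightarrow> (\<forall>j\<in>{2..n}. Treat N (peer N i j) \<omega> = t ! (j - 2))"
  proof
    assume "T \<omega> = t"
    moreover have "T \<omega> ! (j - 2) = Treat N (peer N i j) \<omega>" if "j \<in> {2..n}" for j
    proof -
      have "2 \<le> j" using that by simp
      then obtain k where "j = 2 + k" using le_Suc_ex by blast
      then show ?thesis
        using that by (subst T_eq, subst nth_map) (auto simp del: upt_Suc)
    qed
    ultimately show "\<forall>j\<in>{2..n}. Treat N (peer N i j) \<omega> = t ! (j - 2)"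
      by auto
  next
    assume *: "\<forall>j\<in>{2..n}. Treat N (peer N i j) \<omega> = t ! (j - 2)"
    show "T \<omega> = t"
    proof (rule nth_equalityI)
      fix k assume "k < length (T \<omega>)"
      then have "k < n - 1" by (simp add: T_eq del: upt_Suc)
      then show "T \<omega> ! k = t ! k"
        using *[THEN bspec, of "k + 2"] by (simp add: T_eq add.commute del: upt_Suc)
    qed (simp add: T_eq assms del: upt_Suc)
  qed
  moreover have "(\<Prod>j\<in>J. of_bool (R j)) = (of_bool (\<forall>j\<in>J. R j) :: real)" if "finite J" for J and R :: "nat \<Rightarrow> bool"
    using that by (induction J) auto
  ultimately show ?thesis by simp
qed

lemma expectation_D_Z_T:
  fixes f g :: "nat \<Rightarrow> real"
  assumes t: "t \<in> binvecs (n - 1)"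
  shows "(\<integral>\<omega>. f (D \<omega>) * g (Z \<omega>) * of_bool (T \<omega> = t) \<partial>P) =
    (f 0 * pI 0 + f 1 * pI 1) * (g 0 * pJ 0 + g 1 * pJ 1) * (\<integral>\<omega>. of_bool (T \<omega> = t) \<partial>P)"
proof -
  define q :: real where "q = (\<Prod>j\<in>{2..n}. \<integral>\<omega>. of_bool (Treat N (peer N i j) \<omega> = t ! (j - 2)) \<partial>P)"
  have split: "{0..n} = insert 0 (insert 1 {2..n})"
    using npeers_pos by auto
  have len: "length t = n - 1" using t by (simp add: binvecs_def)
  have *: "(\<integral>\<omega>. f (D \<omega>) * g (Z \<omega>) * of_bool (T \<omega> = t) \<partial>P) =
    (f 0 * pI 0 + f 1 * pI 1) * (g 0 * pJ 0 + g 1 * pJ 1) * q" for f g :: "nat \<Rightarrow> real"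
  proof -
    define \<psi> where "\<psi> j x = (if j = 0 then f x else if j = 1 then g x else of_bool (x = t ! (j - 2)))"
      for j x
    define X where "X j \<omega> = \<psi> j (Treat N (if j = 0 then i else peer N i j) \<omega>)" for j \<omega>
    have X: "X 0 \<omega> = f (D \<omega>)" "X 1 \<omega> = g (Z \<omega>)"
      "j \<in> {2..n} \<Longrightarrow> X j \<omega> = of_bool (Treat N (peer N i j) \<omega> = t ! (j - 2))" for j \<omega>
      by (auto simp: \<psi>_def X_def)
    have split_prod: "(\<Prod>j\<in>{0..n}. G j) = G 0 * G 1 * (\<Prod>j\<in>{2..n}. G j)" for G :: "nat \<Rightarrow> real"
      unfolding split by (simp add: mult.assoc)
    have "(\<integral>\<omega>. f (D \<omega>) * g (Z \<omega>) * of_bool (T \<omega> = t) \<partial>P) = (\<integral>\<omega>. (\<Prod>j\<in>{0..n}. X j \<omega>) \<partial>P)"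
      unfolding split_prod T_eq_iff[OF len] X(1,2) by (simp only: X(3) cong: prod.cong)
    also have "\<dots> = (\<Prod>j\<in>{0..n}. \<integral>\<omega>. X j \<omega> \<partial>P)"
      unfolding X_def by (rule expectation_treats_prod)
    also have "\<dots> = (f 0 * pI 0 + f 1 * pI 1) * (g 0 * pJ 0 + g 1 * pJ 1) * q"
    proof -
      have "(\<integral>\<omega>. X j \<omega> \<partial>P) = (\<integral>\<omega>. of_bool (Treat N (peer N i j) \<omega> = t ! (j - 2)) \<partial>P)" if "j \<in> {2..n}" for j
        by (simp only: X(3)[OF that])
      then show ?thesis
        unfolding split_prod X(1,2) q_def expectation_D expectation_Z by simp
    qed
    finally show ?thesis .
  qed
  \<comment> \<open>With constant functions 1 the first two factors are 1, which identifies
    \<open>q\<close> as the expectation of the indicator of \<open>T = t\<close>.\<close>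
  show ?thesis
    using *[of f g] *[of "\<lambda>_. 1" "\<lambda>_. 1"] by (simp add: pI_sum pJ_sum del: One_nat_def)
qed

section \<open>Factorisation of expectations\<close>

lemma integrable_discrete:
  "integrable P (\<lambda>\<omega>. h (D \<omega>) (peer_treats N i \<omega>) (A \<omega>))" for h :: "_ \<Rightarrow> _ \<Rightarrow> _ \<Rightarrow> real"
proof -
  have "integrable P (\<lambda>\<omega>. h (D \<omega>) (peer_treats N i \<omega>) (A \<omega>) * 1)"
    by (rule integrable_mult_discrete[of "\<lambda>_. 1"]) simp
  then show ?thesis by (simp only: mult_1_right)
qed

text \<open>Fixing the link vector \<open>a\<close> separates the integrand into a function of the
  treatments and a function of \<open>(U, A)\<close>, so the assumed independence applies
  directly.\<close>

lemma expectation_mult_links: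
  fixes F :: "nat \<Rightarrow> nat list \<Rightarrow> real"
  assumes indep: "indep_var (count_space UNIV) (\<lambda>\<omega>. (real (D \<omega>), peer_treats N i \<omega>))
      (borel \<Otimes>\<^sub>M count_space UNIV) (\<lambda>\<omega>. (U \<omega>, A \<omega>))"
    and U: "integrable P U"
  shows "(\<integral>\<omega>. F (D \<omega>) (peer_treats N i \<omega>) * (of_bool (A \<omega> = a) * U \<omega>) \<partial>P) =
    (\<integral>\<omega>. F (D \<omega>) (peer_treats N i \<omega>) \<partial>P) * (\<integral>\<omega>. of_bool (A \<omega> = a) * U \<omega> \<partial>P)"
proof (rule indep_var_lebesgue_integral)
  let ?N = "(borel :: real measure) \<Otimes>\<^sub>M (count_space UNIV :: nat list measure)"
  have "(\<lambda>x. of_bool (snd x = a) :: real) \<in> borel_measurable ?N"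
    by (rule measurable_compose[OF measurable_snd, where g = "\<lambda>y. of_bool (y = a)"]) simp
  then have G: "(\<lambda>x. of_bool (snd x = a) * fst x) \<in> borel_measurable ?N"
    by (rule borel_measurable_times) (rule measurable_fst)
  have F: "(\<lambda>x. F (nat \<lfloor>fst x\<rfloor>) (snd x)) \<in> count_space UNIV \<rightarrow>\<^sub>M (borel :: real measure)"
    by simp
  have "indep_var borel ((\<lambda>x. F (nat \<lfloor>fst x\<rfloor>) (snd x)) \<circ> (\<lambda>\<omega>. (real (D \<omega>), peer_treats N i \<omega>)))
      borel ((\<lambda>x. of_bool (snd x = a) * fst x) \<circ> (\<lambda>\<omega>. (U \<omega>, A \<omega>)))"
    by (rule indep_var_compose[OF indep F G])
  then show "indep_var borel (\<lambda>\<omega>. F (D \<omega>) (peer_treats N i \<omega>)) borel (\<lambda>\<omega>. of_bool (A \<omega> = a) * U \<omega>)"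
    by (simp only: o_def fst_conv snd_conv floor_of_nat nat_int)
  show "integrable P (\<lambda>\<omega>. F (D \<omega>) (peer_treats N i \<omega>))"
    by (rule integrable_discrete[of "\<lambda>d t a. F d t"])
  show "integrable P (\<lambda>\<omega>. of_bool (A \<omega> = a) * U \<omega>)"
    by (rule integrable_mult_discrete[OF U, of "\<lambda>d t a'. of_bool (a' = a)"])
qed

text \<open>\<open>h\<close> ties \<open>T\<close> to \<open>A\<close> and does not factor itself.
  In each term of its expansion over values \<open>(t, a)\<close>, the treatments separate from
  \<open>(U, A)\<close> by \<open>indep\<close>, and \<open>D\<close>, \<open>Z\<close>,
  \<open>T\<close> separate from one another by mutual independence.\<close>

lemma expectation_factor:
  fixes f g :: "nat \<Rightarrow> real" and h :: "nat list \<Rightarrow> nat list \<Rightarrow> real"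
  assumes indep: "indep_var (count_space UNIV) (\<lambda>\<omega>. (real (D \<omega>), peer_treats N i \<omega>))
      (borel \<Otimes>\<^sub>M count_space UNIV) (\<lambda>\<omega>. (U \<omega>, A \<omega>))"
    and U: "integrable P U"
  shows "(\<integral>\<omega>. f (D \<omega>) * g (Z \<omega>) * h (T \<omega>) (A \<omega>) * U \<omega> \<partial>P) =
    (f 0 * pI 0 + f 1 * pI 1) * (g 0 * pJ 0 + g 1 * pJ 1) * (\<integral>\<omega>. h (T \<omega>) (A \<omega>) * U \<omega> \<partial>P)"
proof -
  let ?B = "binvecs (n - 1) \<times> binvecs n"
  have *: "(\<integral>\<omega>. f (D \<omega>) * g (Z \<omega>) * h (T \<omega>) (A \<omega>) * U \<omega> \<partial>P) =
    (\<Sum>(t, a)\<in>?B. h t a * ((f 0 * pI 0 + f 1 * pI 1) * (g 0 * pJ 0 + g 1 * pJ 1) *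
      (\<integral>\<omega>. of_bool (T \<omega> = t) \<partial>P) * (\<integral>\<omega>. of_bool (A \<omega> = a) * U \<omega> \<partial>P)))" for f g :: "nat \<Rightarrow> real"
  proof -
    let ?F = "\<lambda>t \<omega>. f (D \<omega>) * g (Z \<omega>) * of_bool (T \<omega> = t)"
    let ?G = "\<lambda>a \<omega>. of_bool (A \<omega> = a) * U \<omega>"
    have int: "integrable P (\<lambda>\<omega>. h t a * (?F t \<omega> * ?G a \<omega>))" for t a
      using integrable_mult_discrete[OF U, of "\<lambda>d p a'. h t a * (f d * g (hd p) * of_bool (tl p = t)) * of_bool (a' = a)"]
      unfolding Z_eq[symmetric] by (simp only: mult.assoc)
    have "(\<integral>\<omega>. f (D \<omega>) * g (Z \<omega>) * h (T \<omega>) (A \<omega>) * U \<omega> \<partial>P) =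
        (\<integral>\<omega>. (\<Sum>(t, a)\<in>?B. h t a * (?F t \<omega> * ?G a \<omega>)) \<partial>P)"
    proof (rule Bochner_Integration.integral_cong)
      fix \<omega> assume \<omega>: "\<omega> \<in> space P"
      have "(\<Sum>(t, a)\<in>?B. h t a * (?F t \<omega> * ?G a \<omega>)) =
          (\<Sum>(t, a)\<in>?B. of_bool (T \<omega> = t \<and> A \<omega> = a) * (f (D \<omega>) * g (Z \<omega>) * h t a * U \<omega>))"
        by (intro sum.cong) auto
      also have "\<dots> = f (D \<omega>) * g (Z \<omega>) * h (T \<omega>) (A \<omega>) * U \<omega>"
        using \<omega> by (intro sum_of_bool_pair finite_binvecs T_binary links_binary)
      finally show "f (D \<omega>) * g (Z \<omega>) * h (T \<omega>) (A \<omega>) * U \<omega> = (\<Sum>(t, a)\<in>?B. h t a * (?F t \<omega> * ?G a \<omega>))" ..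
    qed simp
    also have "\<dots> = (\<Sum>(t, a)\<in>?B. h t a * (\<integral>\<omega>. ?F t \<omega> * ?G a \<omega> \<partial>P))"
      unfolding split_beta' by (subst Bochner_Integration.integral_sum[OF int]) (simp only: integral_mult_right_zero)
    also have "\<dots> = (\<Sum>(t, a)\<in>?B. h t a * ((\<integral>\<omega>. ?F t \<omega> \<partial>P) * (\<integral>\<omega>. ?G a \<omega> \<partial>P)))"
    proof -
      have "(\<integral>\<omega>. ?F t \<omega> * ?G a \<omega> \<partial>P) = (\<integral>\<omega>. ?F t \<omega> \<partial>P) * (\<integral>\<omega>. ?G a \<omega> \<partial>P)" for t a
        using expectation_mult_links[OF indep U, of "\<lambda>d p. f d * g (hd p) * of_bool (tl p = t)" a]
        unfolding Z_eq[symmetric] .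
      then show ?thesis by (simp only:)
    qed
    also have "\<dots> = (\<Sum>(t, a)\<in>?B. h t a * ((f 0 * pI 0 + f 1 * pI 1) * (g 0 * pJ 0 + g 1 * pJ 1) *
      (\<integral>\<omega>. of_bool (T \<omega> = t) \<partial>P) * (\<integral>\<omega>. of_bool (A \<omega> = a) * U \<omega> \<partial>P)))"
      by (intro sum.cong) (auto simp: expectation_D_Z_T simp del: One_nat_def)
    finally show ?thesis .
  qed
  \<comment> \<open>For constants 1 the two scalar factors are 1, so the same expansion reassembles
    the expectation of \<open>h (T \<omega>) (A \<omega>) * U \<omega>\<close>.\<close>
  show ?thesis
    unfolding *[of f g] using *[of "\<lambda>_. 1" "\<lambda>_. 1"]
    by (simp add: pI_sum pJ_sum sum_distrib_left split_beta' mult.assoc mult.left_commute[of "h _ _"] del: One_nat_def)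
qed

text \<open>Here the instrument stays inside \<open>h\<close>. Splitting by its value
  \<open>z\<close> turns \<open>h\<close> into a function of the remaining peers and the links, and
  the case of constant \<open>f\<close> sums the pieces up again.\<close>

lemma expectation_factor_own:
  fixes f :: "nat \<Rightarrow> real" and h :: "nat list \<Rightarrow> nat list \<Rightarrow> real"
  assumes indep: "indep_var (count_space UNIV) (\<lambda>\<omega>. (real (D \<omega>), peer_treats N i \<omega>))
      (borel \<Otimes>\<^sub>M count_space UNIV) (\<lambda>\<omega>. (U \<omega>, A \<omega>))"
    and U: "integrable P U"
  shows "(\<integral>\<omega>. f (D \<omega>) * h (peer_treats N i \<omega>) (A \<omega>) * U \<omega> \<partial>P) =
    (f 0 * pI 0 + f 1 * pI 1) * (\<integral>\<omega>. h (peer_treats N i \<omega>) (A \<omega>) * U \<omega> \<partial>P)"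
proof -
  let ?g = "\<lambda>z x. of_bool (x = z) :: real"
  have *: "(\<integral>\<omega>. f (D \<omega>) * h (peer_treats N i \<omega>) (A \<omega>) * U \<omega> \<partial>P) =
    (f 0 * pI 0 + f 1 * pI 1) * (\<Sum>z\<in>{0, 1}. (?g z 0 * pJ 0 + ?g z 1 * pJ 1) *
      (\<integral>\<omega>. h (z # T \<omega>) (A \<omega>) * U \<omega> \<partial>P))" for f
  proof -
    have int: "integrable P (\<lambda>\<omega>. f (D \<omega>) * ?g z (Z \<omega>) * h (z # T \<omega>) (A \<omega>) * U \<omega>)" for z
      using integrable_mult_discrete[OF U, of "\<lambda>d p a. f d * ?g z (hd p) * h (z # tl p) a"]
      unfolding Z_eq[symmetric] .
    have "(\<integral>\<omega>. f (D \<omega>) * h (peer_treats N i \<omega>) (A \<omega>) * U \<omega> \<partial>P) =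
      (\<integral>\<omega>. (\<Sum>z\<in>{0, 1}. f (D \<omega>) * ?g z (Z \<omega>) * h (z # T \<omega>) (A \<omega>) * U \<omega>) \<partial>P)"
    proof (rule Bochner_Integration.integral_cong)
      fix \<omega> assume "\<omega> \<in> space P"
      from Z_binary[OF this] show "f (D \<omega>) * h (peer_treats N i \<omega>) (A \<omega>) * U \<omega> =
          (\<Sum>z\<in>{0, 1}. f (D \<omega>) * ?g z (Z \<omega>) * h (z # T \<omega>) (A \<omega>) * U \<omega>)"
        by (subst (1) peer_treats_Cons) auto
    qed simp
    also have "\<dots> = (\<Sum>z\<in>{0, 1}. \<integral>\<omega>. f (D \<omega>) * ?g z (Z \<omega>) * h (z # T \<omega>) (A \<omega>) * U \<omega> \<partial>P)"
      by (rule Bochner_Integration.integral_sum) (rule int)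
    also have "\<dots> = (\<Sum>z\<in>{0, 1}. (f 0 * pI 0 + f 1 * pI 1) * (?g z 0 * pJ 0 + ?g z 1 * pJ 1) *
      (\<integral>\<omega>. h (z # T \<omega>) (A \<omega>) * U \<omega> \<partial>P))"
      by (rule sum.cong[OF refl]) (rule expectation_factor[OF indep U, of f "?g _" "\<lambda>t. h (_ # t)"])
    finally show ?thesis by (simp add: sum_distrib_left distrib_left mult.assoc)
  qed
  show ?thesis
    unfolding *[of f] using *[of "\<lambda>_. 1"] by (simp only: pI_sum mult_1_left mult_1_right)
qed

section \<open>The weighted loss of one unit\<close>

lemma expectation_link: "(\<integral>\<omega>. real (A1 \<omega>) \<partial>P) = \<P>(\<omega> in P. A1 \<omega> = 1)"
proof -
  have "A1 \<in> P \<rightarrow>\<^sub>M count_space UNIV"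
    using model focal npeers_pos by (simp add: network_model_def)
  then have "{\<omega>\<in>space P. A1 \<omega> = 1} \<in> events"
    by measurable
  moreover have "(\<integral>\<omega>. real (A1 \<omega>) \<partial>P) = (\<integral>\<omega>. indicator {\<omega>\<in>space P. A1 \<omega> = 1} \<omega> \<partial>P)"
  proof (rule Bochner_Integration.integral_cong)
    fix \<omega> assume \<omega>: "\<omega> \<in> space P"
    from A1_binary[OF \<omega>] \<omega> show "real (A1 \<omega>) = indicator {\<omega>\<in>space P. A1 \<omega> = 1} \<omega>"
      by (auto simp: indicator_def)
  qed simp
  ultimately show ?thesis by simp
qed

text \<open>The weight \<open>A1\<close> is a function of the links, so it goes through the
  factorisation as \<open>h\<close>, with \<open>U = 1\<close>.\<close>

lemma expectation_A1_D_Z: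
  fixes f g :: "nat \<Rightarrow> real"
  shows "(\<integral>\<omega>. real (A1 \<omega>) * (f (D \<omega>) * g (Z \<omega>)) \<partial>P) =
    (f 0 * pI 0 + f 1 * pI 1) * (g 0 * pJ 0 + g 1 * pJ 1) * \<P>(\<omega> in P. A1 \<omega> = 1)"
  using expectation_factor[OF indep_one, of f g "\<lambda>t a. real (hd a)"]
  by (simp add: A1_eq[symmetric] expectation_link mult_ac del: One_nat_def)

text \<open>The fitted value is \<open>\<alpha> + ad * (D - pI 1) + as * (Z - pJ 1)\<close> with
  \<open>\<alpha> = a0 + pI 1 * ad + pJ 1 * as\<close>. Expanding the square in these terms leaves
  no products of different coefficients.\<close>

lemma weighted_loss_expand:
  assumes int: "\<And>h :: nat \<Rightarrow> nat list \<Rightarrow> nat list \<Rightarrow> real. integrable P (\<lambda>\<omega>. h (D \<omega>) (peer_treats N i \<omega>) (A \<omega>) * X \<omega>)"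
    "integrable P (\<lambda>\<omega>. real (A1 \<omega>) * (X \<omega>)\<^sup>2)"
  shows "(\<integral>\<omega>. real (A1 \<omega>) * (X \<omega> - a0 - ad * real (D \<omega>) - as * real (Z \<omega>))\<^sup>2 \<partial>P) =
    (\<integral>\<omega>. real (A1 \<omega>) * (X \<omega>)\<^sup>2 \<partial>P)
    - 2 * ((a0 + pI 1 * ad + pJ 1 * as) * (\<integral>\<omega>. real (A1 \<omega>) * X \<omega> \<partial>P)
      + ad * (\<integral>\<omega>. real (A1 \<omega>) * ((real (D \<omega>) - pI 1) * X \<omega>) \<partial>P)
      + as * (\<integral>\<omega>. real (A1 \<omega>) * ((real (Z \<omega>) - pJ 1) * X \<omega>) \<partial>P))
    + \<P>(\<omega> in P. A1 \<omega> = 1) * (a0 + pI 1 * ad + pJ 1 * as)\<^sup>2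
    + \<P>(\<omega> in P. A1 \<omega> = 1) * (pI 0 * pI 1) * ad\<^sup>2
    + \<P>(\<omega> in P. A1 \<omega> = 1) * (pJ 0 * pJ 1) * as\<^sup>2"
proof -
  define \<alpha> where "\<alpha> = a0 + pI 1 * ad + pJ 1 * as"
  let ?D = "\<lambda>\<omega>. real (D \<omega>) - pI 1"
  let ?Z = "\<lambda>\<omega>. real (Z \<omega>) - pJ 1"
  let ?A = "\<lambda>\<omega>. real (A1 \<omega>)"
  have intX: "integrable P (\<lambda>\<omega>. ?A \<omega> * X \<omega>)" "integrable P (\<lambda>\<omega>. ?A \<omega> * (?D \<omega> * X \<omega>))"
    "integrable P (\<lambda>\<omega>. ?A \<omega> * (?Z \<omega> * X \<omega>))"
    using int(1)[of "\<lambda>d t a. real (hd a)"] int(1)[of "\<lambda>d t a. real (hd a) * (real d - pI 1)"]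
      int(1)[of "\<lambda>d t a. real (hd a) * (real (hd t) - pJ 1)"]
    by (simp_all add: A1_eq[symmetric] Z_eq[symmetric] mult.assoc)
  let ?L = "\<lambda>\<omega>. ?A \<omega> * (\<alpha> + ad * ?D \<omega> + as * ?Z \<omega>)\<^sup>2"
  have intL: "integrable P ?L"
    using integrable_discrete[of "\<lambda>d t a. real (hd a) * (\<alpha> + ad * (real d - pI 1) + as * (real (hd t) - pJ 1))\<^sup>2"]
    by (simp only: A1_eq[symmetric] Z_eq[symmetric])
  have ABC: "integrable P (\<lambda>\<omega>. ?A \<omega> * (f (D \<omega>) * g (Z \<omega>)))" for f g :: "nat \<Rightarrow> real"
    using integrable_discrete[of "\<lambda>d t a. real (hd a) * (f d * g (hd t))"]
    by (simp only: A1_eq[symmetric] Z_eq[symmetric])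
  \<comment> \<open>\<open>?M k l\<close> has as integrals the weighted mixed moments of the centred
    regressors. An exponent 1 makes the moment vanish, an exponent 2 contributes a variance
    \<open>pI 0 * pI 1\<close> or \<open>pJ 0 * pJ 1\<close>.\<close>
  let ?f = "\<lambda>k x. (real x - pI 1) ^ k"
  let ?g = "\<lambda>k x. (real x - pJ 1) ^ k"
  let ?M = "\<lambda>k l \<omega>. ?A \<omega> * (?f k (D \<omega>) * ?g l (Z \<omega>))"
  have intM: "integrable P (?M k l)" for k l
    by (rule ABC[of "?f k" "?g l"])
  have M: "(\<integral>\<omega>. ?M k l \<omega> \<partial>P) = (?f k 0 * pI 0 + ?f k 1 * pI 1) * (?g l 0 * pJ 0 + ?g l 1 * pJ 1) *
      \<P>(\<omega> in P. A1 \<omega> = 1)" for k l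
    by (rule expectation_A1_D_Z[of "?f k" "?g l"])
  have "(\<integral>\<omega>. ?L \<omega> \<partial>P) = (\<integral>\<omega>. \<alpha>\<^sup>2 * ?M 0 0 \<omega> + ad\<^sup>2 * ?M 2 0 \<omega> + as\<^sup>2 * ?M 0 2 \<omega>
      + 2 * \<alpha> * ad * ?M 1 0 \<omega> + 2 * \<alpha> * as * ?M 0 1 \<omega> + 2 * ad * as * ?M 1 1 \<omega> \<partial>P)"
    by (intro Bochner_Integration.integral_cong) (auto simp: power2_eq_square algebra_simps)
  also have "\<dots> = \<alpha>\<^sup>2 * (\<integral>\<omega>. ?M 0 0 \<omega> \<partial>P) + ad\<^sup>2 * (\<integral>\<omega>. ?M 2 0 \<omega> \<partial>P) + as\<^sup>2 * (\<integral>\<omega>. ?M 0 2 \<omega> \<partial>P)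
      + 2 * \<alpha> * ad * (\<integral>\<omega>. ?M 1 0 \<omega> \<partial>P) + 2 * \<alpha> * as * (\<integral>\<omega>. ?M 0 1 \<omega> \<partial>P) + 2 * ad * as * (\<integral>\<omega>. ?M 1 1 \<omega> \<partial>P)"
    using intM by (simp only: Bochner_Integration.integral_add integrable_mult_right Bochner_Integration.integrable_add integral_mult_right_zero)
  also have "\<dots> = \<P>(\<omega> in P. A1 \<omega> = 1) * \<alpha>\<^sup>2 + \<P>(\<omega> in P. A1 \<omega> = 1) * (pI 0 * pI 1) * ad\<^sup>2
      + \<P>(\<omega> in P. A1 \<omega> = 1) * (pJ 0 * pJ 1) * as\<^sup>2"
  proof -
    have p: "pI 0 = 1 - pI 1" "pJ 0 = 1 - pJ 1" using pI_sum pJ_sum by auto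
    show ?thesis
      unfolding M p by (simp add: power2_eq_square algebra_simps)
  qed
  finally have L: "(\<integral>\<omega>. ?L \<omega> \<partial>P) = \<dots>" .
  have "(\<integral>\<omega>. ?A \<omega> * (X \<omega> - a0 - ad * real (D \<omega>) - as * real (Z \<omega>))\<^sup>2 \<partial>P) =
    (\<integral>\<omega>. ?A \<omega> * (X \<omega>)\<^sup>2 - 2 * (\<alpha> * (?A \<omega> * X \<omega>) + ad * (?A \<omega> * (?D \<omega> * X \<omega>)) + as * (?A \<omega> * (?Z \<omega> * X \<omega>)))
      + ?L \<omega> \<partial>P)"
    by (intro Bochner_Integration.integral_cong) (auto simp: power2_eq_square algebra_simps \<alpha>_def)
  also have "\<dots> = (\<integral>\<omega>. ?A \<omega> * (X \<omega>)\<^sup>2 \<partial>P) - 2 * (\<alpha> * (\<integral>\<omega>. ?A \<omega> * X \<omega> \<partial>P)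
      + ad * (\<integral>\<omega>. ?A \<omega> * (?D \<omega> * X \<omega>) \<partial>P) + as * (\<integral>\<omega>. ?A \<omega> * (?Z \<omega> * X \<omega>) \<partial>P)) + (\<integral>\<omega>. ?L \<omega> \<partial>P)"
    using intX intL int(2)
    by (simp only: Bochner_Integration.integral_add Bochner_Integration.integral_diff integrable_mult_right Bochner_Integration.integrable_add Bochner_Integration.integrable_diff integral_mult_right_zero)
  finally show ?thesis unfolding L \<alpha>_def[symmetric] by simp
qed

section \<open>Moments of exposure and outcome with the centred regressors\<close>

text \<open>With \<open>q = pJ 1\<close>, the instrument value 1 has weight
  \<open>(1 - q) * q\<close> and the value 0 has weight \<open>- q * (1 - q)\<close>. The common
  variance comes out and a contrast in the first peer treatment remains.\<close>

lemma expectation_instrument: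
  fixes f :: "nat \<Rightarrow> real" and h :: "nat list \<Rightarrow> nat list \<Rightarrow> real"
  assumes indep: "indep_var (count_space UNIV) (\<lambda>\<omega>. (real (D \<omega>), peer_treats N i \<omega>))
      (borel \<Otimes>\<^sub>M count_space UNIV) (\<lambda>\<omega>. (U \<omega>, A \<omega>))"
    and U: "integrable P U"
  shows "(\<integral>\<omega>. f (D \<omega>) * (real (Z \<omega>) - pJ 1) * h (peer_treats N i \<omega>) (A \<omega>) * U \<omega> \<partial>P) =
    (f 0 * pI 0 + f 1 * pI 1) * (pJ 0 * pJ 1) * (\<integral>\<omega>. (h (1 # T \<omega>) (A \<omega>) - h (0 # T \<omega>) (A \<omega>)) * U \<omega> \<partial>P)"
proof -
  let ?g = "\<lambda>z x. of_bool (x = z) * (real z - pJ 1)"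
  let ?G = "\<lambda>z \<omega>. f (D \<omega>) * ?g z (Z \<omega>) * h (z # T \<omega>) (A \<omega>) * U \<omega>"
  have int: "integrable P (?G z)" for z
    using integrable_mult_discrete[OF U, of "\<lambda>d p a. f d * ?g z (hd p) * h (z # tl p) a"]
    unfolding Z_eq[symmetric] .
  have inth: "integrable P (\<lambda>\<omega>. h (z # T \<omega>) (A \<omega>) * U \<omega>)" for z
    using integrable_mult_discrete[OF U, of "\<lambda>d p a. h (z # tl p) a"] .
  have E: "(\<integral>\<omega>. ?G z \<omega> \<partial>P) = (f 0 * pI 0 + f 1 * pI 1) * (?g z 0 * pJ 0 + ?g z 1 * pJ 1) *
      (\<integral>\<omega>. h (z # T \<omega>) (A \<omega>) * U \<omega> \<partial>P)" for z
    by (rule expectation_factor[OF indep U, of f "?g z" "\<lambda>t. h (z # t)"])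
  have q: "pJ 0 = 1 - pJ 1" using pJ_sum by simp
  have "(\<integral>\<omega>. f (D \<omega>) * (real (Z \<omega>) - pJ 1) * h (peer_treats N i \<omega>) (A \<omega>) * U \<omega> \<partial>P) =
      (\<integral>\<omega>. ?G 1 \<omega> + ?G 0 \<omega> \<partial>P)"
  proof (rule Bochner_Integration.integral_cong)
    fix \<omega> assume "\<omega> \<in> space P"
    from Z_binary[OF this]
    show "f (D \<omega>) * (real (Z \<omega>) - pJ 1) * h (peer_treats N i \<omega>) (A \<omega>) * U \<omega> = ?G 1 \<omega> + ?G 0 \<omega>"
      by (subst (1) peer_treats_Cons) auto
  qed simp
  also have "\<dots> = (f 0 * pI 0 + f 1 * pI 1) * (pJ 0 * pJ 1) *
      ((\<integral>\<omega>. h (1 # T \<omega>) (A \<omega>) * U \<omega> \<partial>P) - (\<integral>\<omega>. h (0 # T \<omega>) (A \<omega>) * U \<omega> \<partial>P))"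
    unfolding Bochner_Integration.integral_add[OF int int] E by (simp add: q algebra_simps del: One_nat_def)
  also have "\<dots> = (f 0 * pI 0 + f 1 * pI 1) * (pJ 0 * pJ 1) *
      (\<integral>\<omega>. (h (1 # T \<omega>) (A \<omega>) - h (0 # T \<omega>) (A \<omega>)) * U \<omega> \<partial>P)"
    unfolding left_diff_distrib Bochner_Integration.integral_diff[OF inth inth] ..
  finally show ?thesis .
qed

lemma treated_peers_at_Suc: "treated_peers_at N i 1 \<omega> = treated_peers_at N i 0 \<omega> + A1 \<omega>"
  by (simp add: treated_peers_at_def)

text \<open>Keeps both counterfactual counts in the range over which potential outcomes are
  indexed.\<close>

lemma treated_peers_at_le:
  assumes \<omega>: "\<omega> \<in> space P" and d: "d \<in> {0, 1}"
  shows "treated_peers_at N i d \<omega> \<le> n"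
proof -
  have "Link N i j \<omega> * Treat N (peer N i j) \<omega> \<le> 1" if "j \<in> {2..n}" for j
  proof -
    have j: "j \<in> {1..n}" using that by simp
    then have "peer N i j \<in> Focal N \<union> PeerSample N" using peer_in_sample by blast
    from treat_binary[OF \<omega> this] link_binary[OF \<omega> j] show ?thesis by auto
  qed
  then have "(\<Sum>j = 2..n. Link N i j \<omega> * Treat N (peer N i j) \<omega>) \<le> of_nat (card {2..n}) * 1"
    by (rule sum_bounded_above)
  moreover have "A1 \<omega> * d \<le> 1" using A1_binary[OF \<omega>] d by auto
  ultimately show ?thesis
    unfolding treated_peers_at_def using npeers_pos by simp
qed

lemma treated_peers_le: "\<omega> \<in> space P \<Longrightarrow> treated_peers N i \<omega> \<le> n"
  using treated_peers_at_le[OF _ Z_binary] by (simp only: treated_peers_at_Z)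

lemma outcome_eq: "\<omega> \<in> space P \<Longrightarrow> outcome N i \<omega> = Y (D \<omega>) (treated_peers N i \<omega>) \<omega>"
  unfolding outcome_def
  by (rule sum_of_bool_pair[where \<phi> = "\<lambda>d r. Y d r \<omega>"]) (use D_binary treated_peers_le in auto)

lemma exposure_eq: "exposure N i \<omega> = Expo N i (dot (A \<omega>) (peer_treats N i \<omega>))"
  by (simp only: exposure_def treated_peers_eq)

text \<open>Each summand contains one potential outcome only, multiplied by a function of treatments
  and links, as the factorisation lemmas require.\<close>

lemma mult_outcome:
  "c * outcome N i \<omega> = (\<Sum>(d, r)\<in>{0, 1} \<times> {0..n}.
    of_bool (D \<omega> = d) * c * of_bool (dot (A \<omega>) (peer_treats N i \<omega>) = r) * Y d r \<omega>)"
  unfolding outcome_def sum_distrib_left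
  by (rule sum.cong) (auto simp: treated_peers_eq)

lemma integrable_outcome:
  fixes h :: "nat \<Rightarrow> nat list \<Rightarrow> nat list \<Rightarrow> real"
  shows "integrable P (\<lambda>\<omega>. h (D \<omega>) (peer_treats N i \<omega>) (A \<omega>) * outcome N i \<omega>)"
  unfolding mult_outcome
proof (rule Bochner_Integration.integrable_sum)
  fix x :: "nat \<times> nat" assume "x \<in> {0, 1} \<times> {0..n}"
  then obtain d r where x: "x = (d, r)" "d \<in> {0, 1}" "r \<in> {0..n}" by blast
  show "integrable P (\<lambda>\<omega>. case x of (d, r) \<Rightarrow> of_bool (D \<omega> = d) * h (D \<omega>) (peer_treats N i \<omega>) (A \<omega>) *
      of_bool (dot (A \<omega>) (peer_treats N i \<omega>) = r) * Y d r \<omega>)"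
    unfolding x(1) prod.case
    by (rule integrable_mult_discrete[OF integrable_PO(1)[OF x(2,3)],
          of "\<lambda>d' t a. of_bool (d' = d) * h d' t a * of_bool (dot a t = r)"])
qed

text \<open>The cells exclude one another, so the square has no cross terms between different
  potential outcomes.\<close>

lemma integrable_outcome_square: "integrable P (\<lambda>\<omega>. real (A1 \<omega>) * (outcome N i \<omega>)\<^sup>2)"
proof -
  have "integrable P (\<lambda>\<omega>. \<Sum>(d, r)\<in>{0, 1} \<times> {0..n}.
      (of_bool (D \<omega> = d \<and> dot (A \<omega>) (peer_treats N i \<omega>) = r) * real (hd (A \<omega>))) * (Y d r \<omega>)\<^sup>2)"
  proof (rule Bochner_Integration.integrable_sum)
    fix x :: "nat \<times> nat" assume "x \<in> {0, 1} \<times> {0..n}"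
    then obtain d r where x: "x = (d, r)" "d \<in> {0, 1}" "r \<in> {0..n}" by blast
    show "integrable P (\<lambda>\<omega>. case x of (d, r) \<Rightarrow>
        (of_bool (D \<omega> = d \<and> dot (A \<omega>) (peer_treats N i \<omega>) = r) * real (hd (A \<omega>))) * (Y d r \<omega>)\<^sup>2)"
      unfolding x(1) prod.case
      by (rule integrable_mult_discrete[OF integrable_PO(2)[OF x(2,3)],
            of "\<lambda>d' t a. of_bool (d' = d \<and> dot a t = r) * real (hd a)"])
  qed
  also have "?this \<longleftrightarrow> ?thesis"
  proof (rule Bochner_Integration.integrable_cong)
    fix \<omega> assume \<omega>: "\<omega> \<in> space P"
    show "(\<Sum>(d, r)\<in>{0, 1} \<times> {0..n}.
        (of_bool (D \<omega> = d \<and> dot (A \<omega>) (peer_treats N i \<omega>) = r) * real (hd (A \<omega>))) * (Y d r \<omega>)\<^sup>2) =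
      real (A1 \<omega>) * (outcome N i \<omega>)\<^sup>2"
      unfolding outcome_eq[OF \<omega>] A1_eq treated_peers_eq[symmetric] mult.assoc
      using D_binary[OF \<omega>] treated_peers_le[OF \<omega>]
      by (intro sum_of_bool_pair[where \<phi> = "\<lambda>d r. real (hd (A \<omega>)) * (Y d r \<omega>)\<^sup>2"]) auto
  qed simp
  finally show ?thesis .
qed

lemma events_discrete: "{\<omega>\<in>space P. Q (D \<omega>) (peer_treats N i \<omega>) (A \<omega>)} \<in> events"
proof -
  from measurable_sets[OF design_measurable, of "{((d, t), a) | d t a. Q d t a}"]
  show ?thesis by (simp add: vimage_def Int_def conj_commute)
qed

lemma prob_discrete:
  "\<P>(\<omega> in P. Q (D \<omega>) (peer_treats N i \<omega>) (A \<omega>)) =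
    (\<integral>\<omega>. of_bool (Q (D \<omega>) (peer_treats N i \<omega>) (A \<omega>)) \<partial>P)"
proof -
  have "(\<integral>\<omega>. of_bool (Q (D \<omega>) (peer_treats N i \<omega>) (A \<omega>)) \<partial>P) =
      (\<integral>\<omega>. indicator {\<omega>\<in>space P. Q (D \<omega>) (peer_treats N i \<omega>) (A \<omega>)} \<omega> \<partial>P :: real)"
    by (rule Bochner_Integration.integral_cong) (auto simp: indicator_def)
  then show ?thesis using events_discrete[of Q] by simp
qed

lemma exposure_own_moment: "(\<integral>\<omega>. real (A1 \<omega>) * ((real (D \<omega>) - pI 1) * exposure N i \<omega>) \<partial>P) = 0"
proof -
  have "(\<integral>\<omega>. real (A1 \<omega>) * ((real (D \<omega>) - pI 1) * exposure N i \<omega>) \<partial>P) =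
      (\<integral>\<omega>. (real (D \<omega>) - pI 1) * (real (hd (A \<omega>)) * Expo N i (dot (A \<omega>) (peer_treats N i \<omega>))) * 1 \<partial>P)"
    by (simp only: A1_eq exposure_eq mult_1_right mult.left_commute)
  also have "\<dots> = ((real 0 - pI 1) * pI 0 + (real 1 - pI 1) * pI 1) *
      (\<integral>\<omega>. (real (hd (A \<omega>)) * Expo N i (dot (A \<omega>) (peer_treats N i \<omega>))) * 1 \<partial>P)"
    by (rule expectation_factor_own[OF indep_one, of "\<lambda>d. real d - pI 1" "\<lambda>t a. real (hd a) * Expo N i (dot a t)"]) simp
  also have "(real 0 - pI 1) * pI 0 + (real 1 - pI 1) * pI 1 = pI 1 * (1 - (pI 0 + pI 1))"
    by (simp add: algebra_simps)
  finally show ?thesis unfolding pI_sum by simp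
qed

text \<open>When \<open>A1 = 0\<close> the two counterfactual counts agree and the contrast is 0
  anyway, so the weight \<open>A1\<close> disappears from the right-hand side.\<close>

lemma exposure_instrument_moment:
  "(\<integral>\<omega>. real (A1 \<omega>) * ((real (Z \<omega>) - pJ 1) * exposure N i \<omega>) \<partial>P) =
    pJ 0 * pJ 1 * (\<integral>\<omega>. exposure_at N i 1 \<omega> - exposure_at N i 0 \<omega> \<partial>P)"
proof -
  let ?h = "\<lambda>t a. real (hd a) * Expo N i (dot a t)"
  have "(\<integral>\<omega>. real (A1 \<omega>) * ((real (Z \<omega>) - pJ 1) * exposure N i \<omega>) \<partial>P) =
      (\<integral>\<omega>. 1 * (real (Z \<omega>) - pJ 1) * ?h (peer_treats N i \<omega>) (A \<omega>) * 1 \<partial>P)"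
    by (simp only: A1_eq exposure_eq mult_1_right mult_1_left mult.left_commute)
  also have "\<dots> = (1 * pI 0 + 1 * pI 1) * (pJ 0 * pJ 1) *
      (\<integral>\<omega>. (?h (1 # T \<omega>) (A \<omega>) - ?h (0 # T \<omega>) (A \<omega>)) * 1 \<partial>P)"
    by (rule expectation_instrument[OF indep_one, of "\<lambda>_. 1" ?h]) simp
  also have "(\<integral>\<omega>. (?h (1 # T \<omega>) (A \<omega>) - ?h (0 # T \<omega>) (A \<omega>)) * 1 \<partial>P) =
      (\<integral>\<omega>. exposure_at N i 1 \<omega> - exposure_at N i 0 \<omega> \<partial>P)"
  proof (rule Bochner_Integration.integral_cong)
    fix \<omega> assume "\<omega> \<in> space P"
    from A1_binary[OF this] show "(?h (1 # T \<omega>) (A \<omega>) - ?h (0 # T \<omega>) (A \<omega>)) * 1 =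
        exposure_at N i 1 \<omega> - exposure_at N i 0 \<omega>"
      unfolding exposure_at_def treated_peers_at_eq[symmetric] A1_eq[symmetric] treated_peers_at_Suc by auto
  qed simp
  finally show ?thesis by (simp only: mult_1_left pI_sum)
qed

text \<open>With \<open>p = pI 1\<close>, cell \<open>(1, r)\<close> gets the factor
  \<open>(1 - p) * p\<close> and cell \<open>(0, r)\<close> the factor \<open>- p * (1 - p)\<close>.
  Both carry the same indicator of the count, so their sum is a direct effect.\<close>

lemma outcome_own_moment:
  "(\<integral>\<omega>. real (A1 \<omega>) * ((real (D \<omega>) - pI 1) * outcome N i \<omega>) \<partial>P) =
    pI 0 * pI 1 * (\<Sum>r\<in>{0..n}. \<integral>\<omega>. real (A1 \<omega>) * of_bool (treated_peers N i \<omega> = r) * direct_effect N i r \<omega> \<partial>P)"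
proof -
  let ?f = "\<lambda>d x. of_bool (x = d) * (real x - pI 1)"
  let ?h = "\<lambda>r t a. real (hd a) * of_bool (dot a t = r)"
  have int: "integrable P (\<lambda>\<omega>. k (D \<omega>) * ?h r (peer_treats N i \<omega>) (A \<omega>) * Y d r \<omega>)"
    if "d \<in> {0, 1}" "r \<in> {0..n}" for d r and k :: "nat \<Rightarrow> real"
    by (rule integrable_mult_discrete[OF integrable_PO(1)[OF that], of "\<lambda>d' t a. k d' * ?h r t a"])
  have int1: "integrable P (\<lambda>\<omega>. ?h r (peer_treats N i \<omega>) (A \<omega>) * Y d r \<omega>)"
    if "d \<in> {0, 1}" "r \<in> {0..n}" for d r
    by (rule integrable_mult_discrete[OF integrable_PO(1)[OF that], of "\<lambda>d' t a. ?h r t a"])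
  have p: "pI 0 = 1 - pI 1" using pI_sum by simp
  have "(\<integral>\<omega>. real (A1 \<omega>) * ((real (D \<omega>) - pI 1) * outcome N i \<omega>) \<partial>P) =
      (\<integral>\<omega>. (\<Sum>(d, r)\<in>{0, 1} \<times> {0..n}. ?f d (D \<omega>) * ?h r (peer_treats N i \<omega>) (A \<omega>) * Y d r \<omega>) \<partial>P)"
    by (subst mult.assoc[symmetric], subst mult_outcome) (simp only: A1_eq mult_ac)
  also have "\<dots> = (\<Sum>(d, r)\<in>{0, 1} \<times> {0..n}. \<integral>\<omega>. ?f d (D \<omega>) * ?h r (peer_treats N i \<omega>) (A \<omega>) * Y d r \<omega> \<partial>P)"
    unfolding split_beta' by (rule Bochner_Integration.integral_sum) (rule int, auto)
  also have "\<dots> = (\<Sum>(d, r)\<in>{0, 1} \<times> {0..n}. (?f d 0 * pI 0 + ?f d 1 * pI 1) *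
      (\<integral>\<omega>. ?h r (peer_treats N i \<omega>) (A \<omega>) * Y d r \<omega> \<partial>P))"
  proof (rule sum.cong[OF refl])
    fix x :: "nat \<times> nat" assume "x \<in> {0, 1} \<times> {0..n}"
    then obtain d r where x: "x = (d, r)" "d \<in> {0, 1}" "r \<in> {0..n}" by blast
    show "(case x of (d, r) \<Rightarrow> \<integral>\<omega>. ?f d (D \<omega>) * ?h r (peer_treats N i \<omega>) (A \<omega>) * Y d r \<omega> \<partial>P) =
      (case x of (d, r) \<Rightarrow> (?f d 0 * pI 0 + ?f d 1 * pI 1) * (\<integral>\<omega>. ?h r (peer_treats N i \<omega>) (A \<omega>) * Y d r \<omega> \<partial>P))"
      unfolding x(1) prod.case
      by (rule expectation_factor_own[OF indep_PO[OF x(2,3)] integrable_PO(1)[OF x(2,3)], of "?f d" "?h r"])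
  qed
  also have "\<dots> = (\<Sum>r\<in>{0..n}. pI 0 * pI 1 * ((\<integral>\<omega>. ?h r (peer_treats N i \<omega>) (A \<omega>) * Y 1 r \<omega> \<partial>P) -
      (\<integral>\<omega>. ?h r (peer_treats N i \<omega>) (A \<omega>) * Y 0 r \<omega> \<partial>P)))"
    unfolding sum.cartesian_product[symmetric]
    by (simp add: sum.distrib[symmetric] p algebra_simps del: One_nat_def)
  also have "\<dots> = (\<Sum>r\<in>{0..n}. pI 0 * pI 1 * (\<integral>\<omega>. ?h r (peer_treats N i \<omega>) (A \<omega>) * direct_effect N i r \<omega> \<partial>P))"
  proof (rule sum.cong[OF refl])
    fix r assume r: "r \<in> {0..n}"
    have "(\<integral>\<omega>. ?h r (peer_treats N i \<omega>) (A \<omega>) * direct_effect N i r \<omega> \<partial>P) =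
      (\<integral>\<omega>. ?h r (peer_treats N i \<omega>) (A \<omega>) * Y 1 r \<omega> \<partial>P) - (\<integral>\<omega>. ?h r (peer_treats N i \<omega>) (A \<omega>) * Y 0 r \<omega> \<partial>P)"
      unfolding direct_effect_def right_diff_distrib
      by (rule Bochner_Integration.integral_diff; rule int1[OF _ r]; simp)
    then show "pI 0 * pI 1 * ((\<integral>\<omega>. ?h r (peer_treats N i \<omega>) (A \<omega>) * Y 1 r \<omega> \<partial>P) -
      (\<integral>\<omega>. ?h r (peer_treats N i \<omega>) (A \<omega>) * Y 0 r \<omega> \<partial>P)) =
      pI 0 * pI 1 * (\<integral>\<omega>. ?h r (peer_treats N i \<omega>) (A \<omega>) * direct_effect N i r \<omega> \<partial>P)" by simp
  qed
  finally show ?thesis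
    unfolding A1_eq treated_peers_eq sum_distrib_left .
qed

text \<open>Once \<open>A = a\<close> is fixed, the count is determined by the peer treatments. The
  joint probability is thus that of \<open>dot a (peer_treats N i \<omega>) = r\<close> times that
  of \<open>A = a\<close>; the latter cancels the denominator of \<open>cond_expect\<close>, and the
  former moves back under the integral.\<close>

lemma direct_effect_weight:
  assumes r: "r \<in> {0..n}"
  shows "cond_expect P (direct_effect N i r) (\<lambda>\<omega>. A \<omega> = a) * \<P>(\<omega> in P. treated_peers N i \<omega> = r \<and> A \<omega> = a) =
    (\<integral>\<omega>. of_bool (dot a (peer_treats N i \<omega>) = r) * (of_bool (A \<omega> = a) * direct_effect N i r \<omega>) \<partial>P)"
proof -
  let ?F = "\<lambda>\<omega>. of_bool (dot a (peer_treats N i \<omega>) = r) :: real"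
  let ?G = "\<lambda>\<omega>. of_bool (A \<omega> = a) :: real"
  have int: "integrable P (\<lambda>\<omega>. ?F \<omega> * (?G \<omega> * Y d r \<omega>))" "integrable P (\<lambda>\<omega>. ?G \<omega> * Y d r \<omega>)"
    if "d \<in> {0, 1}" for d
    unfolding mult.assoc[symmetric]
    by (rule integrable_mult_discrete[OF integrable_PO(1)[OF that r], of "\<lambda>d t a'. of_bool (dot a t = r) * of_bool (a' = a)"],
        rule integrable_mult_discrete[OF integrable_PO(1)[OF that r], of "\<lambda>d t a'. of_bool (a' = a)"])
  \<comment> \<open>Stated for each \<open>Y d r\<close> separately, because the design does not
    make the difference \<open>Y 1 r - Y 0 r\<close> independent of the treatments.\<close>
  have fac: "(\<integral>\<omega>. ?F \<omega> * (?G \<omega> * Y d r \<omega>) \<partial>P) = (\<integral>\<omega>. ?F \<omega> \<partial>P) * (\<integral>\<omega>. ?G \<omega> * Y d r \<omega> \<partial>P)"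
    if "d \<in> {0, 1}" for d
    by (rule expectation_mult_links[OF indep_PO[OF that r] integrable_PO(1)[OF that r], of "\<lambda>d t. of_bool (dot a t = r)"])
  have "\<P>(\<omega> in P. treated_peers N i \<omega> = r \<and> A \<omega> = a) = (\<integral>\<omega>. of_bool (treated_peers N i \<omega> = r \<and> A \<omega> = a) \<partial>P)"
    using prob_discrete[of "\<lambda>d t a'. dot a' t = r \<and> a' = a"] by (simp only: treated_peers_eq)
  also have "\<dots> = (\<integral>\<omega>. ?F \<omega> * (?G \<omega> * 1) \<partial>P)"
    by (rule Bochner_Integration.integral_cong) (auto simp: treated_peers_eq)
  also have "\<dots> = (\<integral>\<omega>. ?F \<omega> \<partial>P) * (\<integral>\<omega>. ?G \<omega> * 1 \<partial>P)"
    by (rule expectation_mult_links[OF indep_one, of "\<lambda>d t. of_bool (dot a t = r)"]) simp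
  also have "(\<integral>\<omega>. ?G \<omega> * 1 \<partial>P) = \<P>(\<omega> in P. A \<omega> = a)"
    using prob_discrete[of "\<lambda>d t a'. a' = a"] by (simp only: mult_1_right)
  finally have "cond_expect P (direct_effect N i r) (\<lambda>\<omega>. A \<omega> = a) * \<P>(\<omega> in P. treated_peers N i \<omega> = r \<and> A \<omega> = a) =
      (\<integral>\<omega>. ?F \<omega> \<partial>P) * (cond_expect P (direct_effect N i r) (\<lambda>\<omega>. A \<omega> = a) * \<P>(\<omega> in P. A \<omega> = a))"
    by (simp only: mult.left_commute)
  also have "\<dots> = (\<integral>\<omega>. ?F \<omega> \<partial>P) * (\<integral>\<omega>. ?G \<omega> * direct_effect N i r \<omega> \<partial>P)"
    by (subst cond_expect_mult_prob) (rule events_discrete[of "\<lambda>d t a'. a' = a"], rule refl)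
  also have "\<dots> = (\<integral>\<omega>. ?F \<omega> * (?G \<omega> * Y 1 r \<omega>) \<partial>P) - (\<integral>\<omega>. ?F \<omega> * (?G \<omega> * Y 0 r \<omega>) \<partial>P)"
    unfolding direct_effect_def right_diff_distrib
    by (subst Bochner_Integration.integral_diff) (use int fac in \<open>auto simp: right_diff_distrib\<close>)
  also have "\<dots> = (\<integral>\<omega>. ?F \<omega> * (?G \<omega> * direct_effect N i r \<omega>) \<partial>P)"
    unfolding direct_effect_def right_diff_distrib
    by (rule Bochner_Integration.integral_diff[symmetric]; rule int; simp)
  finally show ?thesis .
qed

text \<open>The weight \<open>A1\<close> selects exactly the link vectors that begin with 1, and
  these index the sum.\<close>

lemma direct_effect_sum:
  assumes r: "r \<in> {0..n}"
  shows "(\<integral>\<omega>. real (A1 \<omega>) * of_bool (treated_peers N i \<omega> = r) * direct_effect N i r \<omega> \<partial>P) =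
    (\<Sum>a\<in>(#) 1 ` binvecs (n - 1). cond_expect P (direct_effect N i r) (\<lambda>\<omega>. A \<omega> = a) *
      \<P>(\<omega> in P. treated_peers N i \<omega> = r \<and> A \<omega> = a))"
proof -
  let ?X = "\<lambda>a \<omega>. of_bool (dot a (peer_treats N i \<omega>) = r) * (of_bool (A \<omega> = a) * direct_effect N i r \<omega>)"
  let ?S = "(#) 1 ` binvecs (n - 1)"
  have U: "integrable P (direct_effect N i r)"
  proof -
    have "integrable P (\<lambda>\<omega>. Y 1 r \<omega> - Y 0 r \<omega>)"
      by (rule Bochner_Integration.integrable_diff; rule integrable_PO(1)[OF _ r]; simp)
    then show ?thesis by (simp only: direct_effect_def[abs_def])
  qed
  have int: "integrable P (?X a)" for a
    unfolding mult.assoc[symmetric]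
    by (rule integrable_mult_discrete[OF U, of "\<lambda>d t a'. of_bool (dot a t = r) * of_bool (a' = a)"])
  have "(\<integral>\<omega>. real (A1 \<omega>) * of_bool (treated_peers N i \<omega> = r) * direct_effect N i r \<omega> \<partial>P) =
      (\<integral>\<omega>. (\<Sum>a\<in>?S. ?X a \<omega>) \<partial>P)"
  proof (rule Bochner_Integration.integral_cong)
    fix \<omega> assume \<omega>: "\<omega> \<in> space P"
    have "(\<Sum>a\<in>?S. ?X a \<omega>) = (\<Sum>a\<in>?S. if a = A \<omega> then
        of_bool (treated_peers N i \<omega> = r) * direct_effect N i r \<omega> else 0)"
      by (rule sum.cong) (auto simp: treated_peers_eq)
    also have "\<dots> = (if A \<omega> \<in> ?S then of_bool (treated_peers N i \<omega> = r) * direct_effect N i r \<omega> else 0)"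
      by (rule sum.delta) (simp add: finite_binvecs)
    also have "A \<omega> \<in> ?S \<longleftrightarrow> A1 \<omega> = 1"
      using links_binary[OF \<omega>] links_Cons[of \<omega>] by (auto simp: binvecs_def image_iff)
    also have "(if A1 \<omega> = 1 then of_bool (treated_peers N i \<omega> = r) * direct_effect N i r \<omega> else 0) =
        real (A1 \<omega>) * of_bool (treated_peers N i \<omega> = r) * direct_effect N i r \<omega>"
      using A1_binary[OF \<omega>] by auto
    finally show "real (A1 \<omega>) * of_bool (treated_peers N i \<omega> = r) * direct_effect N i r \<omega> = (\<Sum>a\<in>?S. ?X a \<omega>)" ..
  qed simp
  also have "\<dots> = (\<Sum>a\<in>?S. \<integral>\<omega>. ?X a \<omega> \<partial>P)"
    by (rule Bochner_Integration.integral_sum) (rule int)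
  finally show ?thesis unfolding direct_effect_weight[OF r] .
qed

lemma outcome_own_moment_cond:
  "(\<integral>\<omega>. real (A1 \<omega>) * ((real (D \<omega>) - pI 1) * outcome N i \<omega>) \<partial>P) =
    pI 0 * pI 1 * (\<Sum>(r, a)\<in>{0..n} \<times> (#) 1 ` binvecs (n - 1).
      cond_expect P (direct_effect N i r) (\<lambda>\<omega>. A \<omega> = a) * \<P>(\<omega> in P. treated_peers N i \<omega> = r \<and> A \<omega> = a))"
  unfolding outcome_own_moment sum.cartesian_product[symmetric]
  by (simp only: direct_effect_sum cong: sum.cong)

text \<open>A contrast at a single \<open>r\<close> is not yet a spillover effect, as
  \<open>Y d (r - 1)\<close> sits in the neighbouring cell; only the sums over all \<open>r\<close>
  agree. The indicator of \<open>D = d\<close> contributes \<open>pI d\<close>, which produces the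
  average over own treatment.\<close>

lemma outcome_instrument_moment:
  "(\<integral>\<omega>. real (A1 \<omega>) * ((real (Z \<omega>) - pJ 1) * outcome N i \<omega>) \<partial>P) =
    pJ 0 * pJ 1 * (\<Sum>r = 1..n. cond_expect P (mean_spill_effect N pI i r)
        (\<lambda>\<omega>. treated_peers_at N i 1 \<omega> \<ge> r \<and> r > treated_peers_at N i 0 \<omega>) *
      \<P>(\<omega> in P. treated_peers_at N i 1 \<omega> \<ge> r \<and> r > treated_peers_at N i 0 \<omega>))"
proof -
  let ?R = "treated_peers_at N i"
  let ?C = "\<lambda>r \<omega>. ?R 1 \<omega> \<ge> r \<and> r > ?R 0 \<omega>"
  let ?f = "\<lambda>d x. of_bool (x = d) :: real"
  let ?h = "\<lambda>r t a. real (hd a) * of_bool (dot a t = r)"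
  let ?E = "\<lambda>d r \<omega>. (?h r (1 # T \<omega>) (A \<omega>) - ?h r (0 # T \<omega>) (A \<omega>)) * Y d r \<omega>"
  have int: "integrable P (\<lambda>\<omega>. ?f d (D \<omega>) * (real (Z \<omega>) - pJ 1) * ?h r (peer_treats N i \<omega>) (A \<omega>) * Y d r \<omega>)"
    if "d \<in> {0, 1}" "r \<in> {0..n}" for d r
    unfolding Z_eq
    by (rule integrable_mult_discrete[OF integrable_PO(1)[OF that],
          of "\<lambda>d' t a. ?f d d' * (real (hd t) - pJ 1) * ?h r t a"])
  have intE: "integrable P (?E d r)" if "d \<in> {0, 1}" "r \<in> {0..n}" for d r
    by (rule integrable_mult_discrete[OF integrable_PO(1)[OF that],
          of "\<lambda>d' t a. ?h r (1 # tl t) a - ?h r (0 # tl t) a"])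
  have intS: "integrable P (\<lambda>\<omega>. of_bool (?C r \<omega>) * spill_effect N i d r \<omega>)"
    if d: "d \<in> {0, 1}" and r: "r \<in> {1..n}" for d r
    unfolding treated_peers_at_eq
  proof (rule integrable_mult_discrete[where h = "\<lambda>d t a. of_bool (dot a (1 # tl t) \<ge> r \<and> r > dot a (0 # tl t))"])
    have "integrable P (\<lambda>\<omega>. Y d r \<omega> - Y d (r - 1) \<omega>)"
      by (rule Bochner_Integration.integrable_diff; rule integrable_PO(1)[OF d]; use r in auto)
    then show "integrable P (spill_effect N i d r)"
      by (simp only: spill_effect_def[abs_def])
  qed
  \<comment> \<open>The indicators in \<open>?E\<close> pick \<open>r = ?R 1 \<omega>\<close> and
    \<open>r = ?R 0 \<omega>\<close>. If \<open>A1 = 1\<close> these are neighbours, and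
    \<open>r = ?R 1 \<omega>\<close>, which is at least 1, is the only \<open>r\<close> satisfying
    \<open>?C\<close>. If \<open>A1 = 0\<close> both sides are 0.\<close>
  have telescope: "(\<Sum>r\<in>{0..n}. ?E d r \<omega>) = (\<Sum>r = 1..n. of_bool (?C r \<omega>) * spill_effect N i d r \<omega>)"
    if \<omega>: "\<omega> \<in> space P" for d \<omega>
  proof -
    have le: "?R 1 \<omega> \<le> n" by (rule treated_peers_at_le[OF \<omega>]) simp
    have E: "?E d r \<omega> = (if r = ?R 1 \<omega> then real (A1 \<omega>) * Y d r \<omega> else 0) -
        (if r = ?R 0 \<omega> then real (A1 \<omega>) * Y d r \<omega> else 0)" for r
      unfolding treated_peers_at_eq[symmetric] A1_eq[symmetric] by auto
    have "(\<Sum>r\<in>{0..n}. ?E d r \<omega>) = real (A1 \<omega>) * (Y d (?R 1 \<omega>) \<omega> - Y d (?R 0 \<omega>) \<omega>)"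
      using le treated_peers_at_Suc[of \<omega>] unfolding E sum_subtractf by (simp add: algebra_simps del: One_nat_def)
    also have "\<dots> = (\<Sum>r = 1..n. if r = ?R 1 \<omega> then real (A1 \<omega>) * spill_effect N i d r \<omega> else 0)"
    proof (cases "A1 \<omega> = 0")
      case False
      then have "A1 \<omega> = 1" using A1_binary[OF \<omega>] by simp
      then show ?thesis
        using le treated_peers_at_Suc[of \<omega>] by (simp add: spill_effect_def)
    qed simp
    also have "\<dots> = (\<Sum>r = 1..n. of_bool (?C r \<omega>) * spill_effect N i d r \<omega>)"
      using A1_binary[OF \<omega>] treated_peers_at_Suc[of \<omega>] by (intro sum.cong) auto
    finally show ?thesis .
  qed
  have sumE: "(\<Sum>r\<in>{0..n}. \<integral>\<omega>. ?E d r \<omega> \<partial>P) = (\<Sum>r = 1..n. \<integral>\<omega>. of_bool (?C r \<omega>) * spill_effect N i d r \<omega> \<partial>P)"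
    if d: "d \<in> {0, 1}" for d
  proof -
    have "(\<Sum>r\<in>{0..n}. \<integral>\<omega>. ?E d r \<omega> \<partial>P) = (\<integral>\<omega>. (\<Sum>r\<in>{0..n}. ?E d r \<omega>) \<partial>P)"
      by (rule Bochner_Integration.integral_sum[symmetric]) (rule intE[OF d])
    also have "\<dots> = (\<integral>\<omega>. (\<Sum>r = 1..n. of_bool (?C r \<omega>) * spill_effect N i d r \<omega>) \<partial>P)"
      by (rule Bochner_Integration.integral_cong[OF refl]) (rule telescope)
    also have "\<dots> = (\<Sum>r = 1..n. \<integral>\<omega>. of_bool (?C r \<omega>) * spill_effect N i d r \<omega> \<partial>P)"
      by (rule Bochner_Integration.integral_sum) (rule intS[OF d])
    finally show ?thesis .
  qed
  have "(\<integral>\<omega>. real (A1 \<omega>) * ((real (Z \<omega>) - pJ 1) * outcome N i \<omega>) \<partial>P) =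
      (\<integral>\<omega>. (\<Sum>(d, r)\<in>{0, 1} \<times> {0..n}. ?f d (D \<omega>) * (real (Z \<omega>) - pJ 1) * ?h r (peer_treats N i \<omega>) (A \<omega>) * Y d r \<omega>) \<partial>P)"
    by (subst mult.assoc[symmetric], subst mult_outcome) (simp only: A1_eq mult_ac)
  also have "\<dots> = (\<Sum>(d, r)\<in>{0, 1} \<times> {0..n}.
      \<integral>\<omega>. ?f d (D \<omega>) * (real (Z \<omega>) - pJ 1) * ?h r (peer_treats N i \<omega>) (A \<omega>) * Y d r \<omega> \<partial>P)"
    unfolding split_beta' by (rule Bochner_Integration.integral_sum) (rule int, auto)
  also have "\<dots> = (\<Sum>(d, r)\<in>{0, 1} \<times> {0..n}. (?f d 0 * pI 0 + ?f d 1 * pI 1) * (pJ 0 * pJ 1) * (\<integral>\<omega>. ?E d r \<omega> \<partial>P))"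
  proof (rule sum.cong[OF refl])
    fix x :: "nat \<times> nat" assume "x \<in> {0, 1} \<times> {0..n}"
    then obtain d r where x: "x = (d, r)" "d \<in> {0, 1}" "r \<in> {0..n}" by blast
    show "(case x of (d, r) \<Rightarrow> \<integral>\<omega>. ?f d (D \<omega>) * (real (Z \<omega>) - pJ 1) * ?h r (peer_treats N i \<omega>) (A \<omega>) * Y d r \<omega> \<partial>P) =
      (case x of (d, r) \<Rightarrow> (?f d 0 * pI 0 + ?f d 1 * pI 1) * (pJ 0 * pJ 1) * (\<integral>\<omega>. ?E d r \<omega> \<partial>P))"
      unfolding x(1) prod.case
      by (rule expectation_instrument[OF indep_PO[OF x(2,3)] integrable_PO(1)[OF x(2,3)], of "?f d" "?h r"])
  qed
  also have "\<dots> = (\<Sum>d\<in>{0, 1}. (?f d 0 * pI 0 + ?f d 1 * pI 1) * (pJ 0 * pJ 1) * (\<Sum>r\<in>{0..n}. \<integral>\<omega>. ?E d r \<omega> \<partial>P))"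
    unfolding sum.cartesian_product[symmetric] sum_distrib_left ..
  also have "\<dots> = (\<Sum>d\<in>{0, 1}. (?f d 0 * pI 0 + ?f d 1 * pI 1) * (pJ 0 * pJ 1) *
      (\<Sum>r = 1..n. \<integral>\<omega>. of_bool (?C r \<omega>) * spill_effect N i d r \<omega> \<partial>P))"
    by (rule sum.cong[OF refl]) (simp only: sumE)
  also have "\<dots> = pJ 0 * pJ 1 * (\<Sum>r = 1..n. pI 1 * (\<integral>\<omega>. of_bool (?C r \<omega>) * spill_effect N i 1 r \<omega> \<partial>P) +
      pI 0 * (\<integral>\<omega>. of_bool (?C r \<omega>) * spill_effect N i 0 r \<omega> \<partial>P))"
    by (simp add: sum.distrib sum_distrib_left[symmetric] distrib_left mult_ac)
  also have "\<dots> = pJ 0 * pJ 1 * (\<Sum>r = 1..n. cond_expect P (mean_spill_effect N pI i r) (?C r) * \<P>(\<omega> in P. ?C r \<omega>))"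
  proof (rule arg_cong[where f = "(*) (pJ 0 * pJ 1)"], rule sum.cong[OF refl])
    fix r assume r: "r \<in> {1..n}"
    have ev: "{\<omega>\<in>space P. ?C r \<omega>} \<in> events"
      unfolding treated_peers_at_eq
      by (rule events_discrete[of "\<lambda>d t a. dot a (1 # tl t) \<ge> r \<and> r > dot a (0 # tl t)"])
    have "cond_expect P (mean_spill_effect N pI i r) (?C r) * \<P>(\<omega> in P. ?C r \<omega>) =
        (\<integral>\<omega>. pI 1 * (of_bool (?C r \<omega>) * spill_effect N i 1 r \<omega>) + pI 0 * (of_bool (?C r \<omega>) * spill_effect N i 0 r \<omega>) \<partial>P)"
      unfolding cond_expect_mult_prob[OF ev] mean_spill_effect_def
      by (rule Bochner_Integration.integral_cong) (auto simp: algebra_simps)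
    also have "\<dots> = pI 1 * (\<integral>\<omega>. of_bool (?C r \<omega>) * spill_effect N i 1 r \<omega> \<partial>P) +
      pI 0 * (\<integral>\<omega>. of_bool (?C r \<omega>) * spill_effect N i 0 r \<omega> \<partial>P)"
      using intS[OF _ r, of 0] intS[OF _ r, of 1]
      by (subst Bochner_Integration.integral_add) (simp_all del: One_nat_def)
    finally show "pI 1 * (\<integral>\<omega>. of_bool (?C r \<omega>) * spill_effect N i 1 r \<omega> \<partial>P) +
      pI 0 * (\<integral>\<omega>. of_bool (?C r \<omega>) * spill_effect N i 0 r \<omega> \<partial>P) =
      cond_expect P (mean_spill_effect N pI i r) (?C r) * \<P>(\<omega> in P. ?C r \<omega>)" ..
  qed
  finally show ?thesis .
qed

end

section \<open>Sum over the focal units and the final formulas\<close>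

text \<open>The treatment probabilities are common to all units, so a single centring serves every
  summand and the total stays separable; the link probabilities add up to \<open>w\<close>.\<close>

lemma total_loss_expand:
  fixes N :: "('u, 'w) network" and X :: "'u \<Rightarrow> 'w \<Rightarrow> real"
  assumes unit: "\<And>i. i \<in> Focal N \<Longrightarrow> focal_unit N pI pJ i"
    and int: "\<And>i h. i \<in> Focal N \<Longrightarrow>
      integrable (Prob N) (\<lambda>\<omega>. h (Treat N i \<omega>) (peer_treats N i \<omega>) (links N i \<omega>) * X i \<omega>)"
    and int2: "\<And>i. i \<in> Focal N \<Longrightarrow> integrable (Prob N) (\<lambda>\<omega>. real (Link N i 1 \<omega>) * (X i \<omega>)\<^sup>2)"
  defines "S \<equiv> \<lambda>U. \<Sum>i\<in>Focal N. \<integral>\<omega>. real (Link N i 1 \<omega>) * U i \<omega> \<partial>Prob N"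
    and "w \<equiv> \<Sum>i\<in>Focal N. \<P>(\<omega> in Prob N. Link N i 1 \<omega> = 1)"
  shows "S (\<lambda>i \<omega>. (X i \<omega> - a0 - ad * real (Treat N i \<omega>) - as * real (Treat N (peer N i 1) \<omega>))\<^sup>2) =
    S (\<lambda>i \<omega>. (X i \<omega>)\<^sup>2) - 2 * ((a0 + pI 1 * ad + pJ 1 * as) * S X
      + ad * S (\<lambda>i \<omega>. (real (Treat N i \<omega>) - pI 1) * X i \<omega>)
      + as * S (\<lambda>i \<omega>. (real (Treat N (peer N i 1) \<omega>) - pJ 1) * X i \<omega>))
    + w * (a0 + pI 1 * ad + pJ 1 * as)\<^sup>2 + w * (pI 0 * pI 1) * ad\<^sup>2 + w * (pJ 0 * pJ 1) * as\<^sup>2"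
proof -
  have "S (\<lambda>i \<omega>. (X i \<omega> - a0 - ad * real (Treat N i \<omega>) - as * real (Treat N (peer N i 1) \<omega>))\<^sup>2) =
    (\<Sum>i\<in>Focal N. (\<integral>\<omega>. real (Link N i 1 \<omega>) * (X i \<omega>)\<^sup>2 \<partial>Prob N)
    - 2 * ((a0 + pI 1 * ad + pJ 1 * as) * (\<integral>\<omega>. real (Link N i 1 \<omega>) * X i \<omega> \<partial>Prob N)
      + ad * (\<integral>\<omega>. real (Link N i 1 \<omega>) * ((real (Treat N i \<omega>) - pI 1) * X i \<omega>) \<partial>Prob N)
      + as * (\<integral>\<omega>. real (Link N i 1 \<omega>) * ((real (Treat N (peer N i 1) \<omega>) - pJ 1) * X i \<omega>) \<partial>Prob N))
    + \<P>(\<omega> in Prob N. Link N i 1 \<omega> = 1) * (a0 + pI 1 * ad + pJ 1 * as)\<^sup>2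
    + \<P>(\<omega> in Prob N. Link N i 1 \<omega> = 1) * (pI 0 * pI 1) * ad\<^sup>2
    + \<P>(\<omega> in Prob N. Link N i 1 \<omega> = 1) * (pJ 0 * pJ 1) * as\<^sup>2)"
    unfolding S_def by (rule sum.cong[OF refl]) (rule focal_unit.weighted_loss_expand[OF unit int int2])
  then show ?thesis
    unfolding S_def w_def
    by (simp only: distrib_left sum_distrib_left sum_distrib_right sum.distrib sum_subtractf)
qed

theorem theorem3p3:
  fixes N :: "('u, 'w) network"
    and pI pJ :: "nat \<Rightarrow> real"
    and \<gamma>0 \<gamma>d \<gamma>s \<beta>0 \<beta>d \<beta>s :: real
    and n :: nat
  assumes "network_model N"
    and "experimental_design N pI pJ"
    and "independent_units N"
    and "n = card (Focal N)"
    and "is_arg_min (first_stage_loss N) (\<lambda>_. True) (\<gamma>0, \<gamma>d, \<gamma>s)"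
    and "{b. is_arg_min (wls_loss N (\<gamma>0, \<gamma>d, \<gamma>s)) (\<lambda>_. True) b} = {(\<beta>0, \<beta>d, \<beta>s)}"
  shows "\<beta>d =
      ((\<Sum>i\<in>Focal N. \<Sum>(r, a)\<in>{0..npeers N i} \<times> (#) 1 ` binvecs (npeers N i - 1).
          cond_expect (Prob N) (direct_effect N i r) (\<lambda>\<omega>. links N i \<omega> = a) *
          \<P>(\<omega> in Prob N. treated_peers N i \<omega> = r \<and> links N i \<omega> = a)) / real n) /
      ((\<Sum>i\<in>Focal N. \<P>(\<omega> in Prob N. Link N i 1 \<omega> = 1)) / real n)
    \<and> \<beta>s =
      (\<Sum>i\<in>Focal N. \<Sum>r = 1..npeers N i.
          spill_weight N i r *
          cond_expect (Prob N) (mean_spill_effect N pI i r)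
            (\<lambda>\<omega>. treated_peers_at N i 1 \<omega> \<ge> r \<and> r > treated_peers_at N i 0 \<omega>)) / real n"
proof -
  have unit: "focal_unit N pI pJ i" if "i \<in> Focal N" for i
    using assms(1,2) that by (rule focal_unit.intro)
  define w where "w = (\<Sum>i\<in>Focal N. \<P>(\<omega> in Prob N. Link N i 1 \<omega> = 1))"
  define S where "S U = (\<Sum>i\<in>Focal N. \<integral>\<omega>. real (Link N i 1 \<omega>) * U i \<omega> \<partial>Prob N)" for U :: "'u \<Rightarrow> 'w \<Rightarrow> real"
  define ED where "ED U = S (\<lambda>i \<omega>. (real (Treat N i \<omega>) - pI 1) * U i \<omega>)" for U
  define EZ where "EZ U = S (\<lambda>i \<omega>. (real (Treat N (peer N i 1) \<omega>) - pJ 1) * U i \<omega>)" for U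
  define L where "L U = (\<lambda>(a0, ad, as).
    S (\<lambda>i \<omega>. (U i \<omega> - a0 - ad * real (Treat N i \<omega>) - as * real (Treat N (peer N i 1) \<omega>))\<^sup>2))" for U
  have int_exposure: "integrable (Prob N) (\<lambda>\<omega>. h (Treat N i \<omega>) (peer_treats N i \<omega>) (links N i \<omega>) * exposure N i \<omega>)"
    "integrable (Prob N) (\<lambda>\<omega>. real (Link N i 1 \<omega>) * (exposure N i \<omega>)\<^sup>2)"
    if i: "i \<in> Focal N" for i and h :: "nat \<Rightarrow> nat list \<Rightarrow> nat list \<Rightarrow> real"
    unfolding focal_unit.exposure_eq[OF unit[OF i]] focal_unit.A1_eq[OF unit[OF i]]
    by (rule focal_unit.integrable_discrete[OF unit[OF i], of "\<lambda>d t a. h d t a * Expo N i (dot a t)"],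
        rule focal_unit.integrable_discrete[OF unit[OF i], of "\<lambda>d t a. real (hd a) * (Expo N i (dot a t))\<^sup>2"])
  have expand_exposure: "L (exposure N) (a0, ad, as) = S (\<lambda>i \<omega>. (exposure N i \<omega>)\<^sup>2) -
      2 * ((a0 + pI 1 * ad + pJ 1 * as) * S (exposure N) + ad * ED (exposure N) + as * EZ (exposure N)) +
      w * (a0 + pI 1 * ad + pJ 1 * as)\<^sup>2 + w * (pI 0 * pI 1) * ad\<^sup>2 + w * (pJ 0 * pJ 1) * as\<^sup>2" for a0 ad as
    unfolding L_def prod.case ED_def EZ_def S_def w_def
    by (rule total_loss_expand[OF unit int_exposure])
  have expand_outcome: "L (outcome N) (a0, ad, as) = S (\<lambda>i \<omega>. (outcome N i \<omega>)\<^sup>2) -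
      2 * ((a0 + pI 1 * ad + pJ 1 * as) * S (outcome N) + ad * ED (outcome N) + as * EZ (outcome N)) +
      w * (a0 + pI 1 * ad + pJ 1 * as)\<^sup>2 + w * (pI 0 * pI 1) * ad\<^sup>2 + w * (pJ 0 * pJ 1) * as\<^sup>2" for a0 ad as
    unfolding L_def prod.case ED_def EZ_def S_def w_def
    by (rule total_loss_expand[OF unit focal_unit.integrable_outcome[OF unit] focal_unit.integrable_outcome_square[OF unit]])
  have first: "first_stage_loss N = L (exposure N)"
    unfolding first_stage_loss_def L_def S_def ..
  have second: "wls_loss N (\<gamma>0, \<gamma>d, \<gamma>s) (b0, bd, bs) = L (outcome N) (b0 + bs * \<gamma>0, bd + bs * \<gamma>d, bs * \<gamma>s)"
    for b0 bd bs
    unfolding wls_loss_def L_def S_def lin_proj_def prod.case by (simp add: algebra_simps)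
  note stage1 = separable_minimizer[OF expand_exposure assms(5)[unfolded first]]
  note stage2 = two_stage_minimizer[OF expand_outcome second assms(6)]
  define Eff where "Eff = (\<Sum>k\<in>Focal N. \<integral>\<omega>. exposure_at N k 1 \<omega> - exposure_at N k 0 \<omega> \<partial>Prob N)"
  define NumD where "NumD = (\<Sum>i\<in>Focal N. \<Sum>(r, a)\<in>{0..npeers N i} \<times> (#) 1 ` binvecs (npeers N i - 1).
      cond_expect (Prob N) (direct_effect N i r) (\<lambda>\<omega>. links N i \<omega> = a) *
      \<P>(\<omega> in Prob N. treated_peers N i \<omega> = r \<and> links N i \<omega> = a))"
  let ?C = "\<lambda>i r \<omega>. treated_peers_at N i 1 \<omega> \<ge> r \<and> r > treated_peers_at N i 0 \<omega>"
  define NumS where "NumS = (\<Sum>i\<in>Focal N. \<Sum>r = 1..npeers N i.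
      cond_expect (Prob N) (mean_spill_effect N pI i r) (?C i r) * \<P>(\<omega> in Prob N. ?C i r \<omega>))"
  have "ED (exposure N) = 0"
    unfolding ED_def S_def by (rule sum.neutral) (use focal_unit.exposure_own_moment[OF unit] in blast)
  have "EZ (exposure N) = pJ 0 * pJ 1 * Eff"
    unfolding EZ_def S_def Eff_def sum_distrib_left
    by (rule sum.cong[OF refl]) (rule focal_unit.exposure_instrument_moment[OF unit])
  have "ED (outcome N) = pI 0 * pI 1 * NumD"
    unfolding ED_def S_def NumD_def sum_distrib_left[of _ _ "Focal N"]
    by (rule sum.cong[OF refl]) (rule focal_unit.outcome_own_moment_cond[OF unit])
  have "EZ (outcome N) = pJ 0 * pJ 1 * NumS"
    unfolding EZ_def S_def NumS_def sum_distrib_left[of _ _ "Focal N"]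
    by (rule sum.cong[OF refl]) (rule focal_unit.outcome_instrument_moment[OF unit])
  note moments = \<open>ED (exposure N) = 0\<close> \<open>EZ (exposure N) = pJ 0 * pJ 1 * Eff\<close>
    \<open>ED (outcome N) = pI 0 * pI 1 * NumD\<close> \<open>EZ (outcome N) = pJ 0 * pJ 1 * NumS\<close>
  have nz: "w \<noteq> 0" "pI 0 * pI 1 \<noteq> 0" "pJ 0 * pJ 1 \<noteq> 0"
    using stage2(1,2) by auto
  \<comment> \<open>Both formulas divide by \<open>n\<close> twice, which cancels only for nonzero
    \<open>n\<close>; an empty focal sample would give \<open>w = 0\<close>.\<close>
  have "n \<noteq> 0"
  proof
    assume "n = 0"
    moreover have "finite (Focal N)" using assms(1) by (simp only: network_model_def)
    ultimately have "Focal N = {}" using assms(4) by simp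
    then show False using nz(1) by (simp add: w_def)
  qed
  \<comment> \<open>The second stage identifies only \<open>\<beta>d + \<beta>s * \<gamma>d\<close>;
    this is \<open>\<beta>d\<close> itself because of \<open>\<gamma>d = 0\<close>.\<close>
  have "\<gamma>d = 0"
    using stage1(1) nz unfolding moments by simp
  then have "w * (pI 0 * pI 1) * \<beta>d = pI 0 * pI 1 * NumD"
    using stage2(3) unfolding moments by simp
  then have D: "\<beta>d = NumD / w"
    using nz by (simp add: field_simps)
  \<comment> \<open>The product \<open>w * \<gamma>s\<close> is also the coefficient of
    \<open>\<beta>s\<close> in the second stage. Hence the denominator of \<open>\<beta>s\<close> is
    the exposure contrast \<open>Eff\<close>, without the link probabilities
    \<open>w\<close>.\<close>
  have "w * \<gamma>s = Eff"
    using stage1(2) nz(3) unfolding moments by (simp add: field_simps)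
  moreover have "w * \<gamma>s * \<beta>s = NumS"
    using stage2(4) nz(3) unfolding moments by (simp add: field_simps)
  moreover have "w * \<gamma>s \<noteq> 0" using stage2(2) by auto
  ultimately have S: "\<beta>s = NumS / Eff" by (simp add: field_simps)
  have "(\<Sum>i\<in>Focal N. \<Sum>r = 1..npeers N i. spill_weight N i r *
      cond_expect (Prob N) (mean_spill_effect N pI i r) (?C i r)) / real n = NumS / Eff"
    using \<open>n \<noteq> 0\<close>
    unfolding spill_weight_def Eff_def[symmetric] NumS_def assms(4)[symmetric]
    by (simp add: sum_divide_distrib mult_ac)
  then show ?thesis
    using D S \<open>n \<noteq> 0\<close> unfolding NumD_def[symmetric] w_def[symmetric] by simp
qed

end
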